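(* Let $(\iota,\Gamma,m)$ be a connected zero tension curve of genus zero and degree $\delta$ in $\mathbb{Q}\otimes\Lambda$. Then there is a (punctured) genus zero curve $X$ over $\mathbb{K}$ and a map $\phi:X\to\mathbb{T}(\mathbb{K},\Lambda)$ such that $(X,\phi)$ has degree $\delta$ and $\iota(\Gamma)=\operatorname{Trop}\phi(X)$.
   Context: **Fields.** $\mathbf{O}$ is a complete discrete valuation ring with valuation $v:\mathbf{O}\to\mathbb{Z}_{\ge 0}\cup\{\infty\}$, fraction field $\mathbf{K}$, and algebraically closed residue field $\kappa$. $\mathbb{K}$ is the algebraic closure of $\mathbf{K}$, and $v:\mathbb{K}\to\mathbb{Q}\cup\{\infty\}$ is the extended valuation. $\Lambda$ is a lattice of rank $n$, $\Lambda^\vee$ its dual, $\mathbb{T}(\mathbb{K},\Lambda)=\operatorname{Hom}(\Lambda^\vee,\mathbb{K}^* )$ the torus, and $\chi^\lambda$ ($\lambda\in\Lambda^\vee$) its characters. **Tropicalization.** For $x\in\mathbb{T}(\mathbb{K},\Lambda)$, $v(x)\in\mathbb{Q}\otimes\Lambda$ is the element with $\langle\lambda,v(x)\rangle=v(\chi^\lambda(x))$. For a map $\phi:X\to\mathbb{T}(\mathbb{K},\Lambda)$, $\operatorname{Trop}\phi(X)=\{v(\phi(x)):x\in X(\mathbb{K})\}\subset\mathbb{Q}\otimes\Lambda$. **Degree of a curve.** Let $X$ be a smooth connected algebraic curve over $\mathbb{K}$ with smooth completion $\overline{X}$ (its genus is that of $\overline X$), and $\phi:X\to\mathbb{T}(\mathbb{K},\Lambda)$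 an algebraic map that does not extend to any point of $\overline{X}\setminus X$. For $x\in\overline{X}\setminus X$ let $\sigma_x\in\Lambda$ be the nonzero vector such that $\langle\lambda,\sigma_x\rangle$ is the order of vanishing of $\chi^\lambda\circ\phi$ at $x$ for every $\lambda\in\Lambda^\vee$; write $\sigma_x=d_x\rho_x$ with $d_x$ a positive integer and $\rho_x$ primitive. Let $\rho_1,\dots,\rho_N$ be the distinct values of $\rho_x$ and $\sigma_i=\sum_{\rho_x=\rho_i}\sigma_x$. The degree of $(X,\phi)$ is the set $\{\sigma_1,\dots,\sigma_N\}$. **Zero tension curves.** Let $\Gamma$ be a finite graph and $\partial\Gamma$ its set of degree $1$ vertices. All graphs and polyhedra consist of rational points (edges have rational endpoints/lengths, points are those at rational distance from vertices), while topological terms (connected, continuous, etc.) refer to the corresponding real objects. Let $\iota:\Gamma\setminus\partial\Gamma\to\mathbb{Q}\otimes\Lambda$ be continuous such that an edge $e$ is taken to a finite line segment or a point if neither endpoint of $e$ is in $\partial\Gamma$, to an unbounded ray if exactly one endpoint is in $\partial\Gamma$, and to a line if both are; such pairs are taken up to reparameterization of edges, and $\iota(e)$ is required to have slope in $\Lambda$. For a vertex $u$ and an edge $e$ with endpoint $u$, $\rho_u(e)$ is the minimal lattice vector parallel to $\iota(e)$ pointing away from (the end at) $u$, and $\rho_u(e)=0$ if $\iota(e)$ is a point. Let $m$ assign a positive integer to each edge and put $\sigma_u(e)=m(e)\rho_u(e)$. $(\iota,\Gamma,m)$ is a zero tension curve if $\sum_{e\ni u}\sigma_u(e)=0$ for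 every vertex $u\in\Gamma\setminus\partial\Gamma$. Its genus is the first Betti number of $\Gamma$. Its degree is defined as follows: let $D\subset\Lambda$ be the set of values $-\rho_u(e)$ for $u\in\partial\Gamma$ ($e$ the edge at $u$); for $\lambda\in D$ let $m_\lambda=\sum m(e)$ over those $e$ with an endpoint $u\in\partial\Gamma$ and $-\rho_u(e)=\lambda$; the degree is $\{m_\lambda\lambda:\lambda\in D\}$. We write $\iota(\Gamma)$ for $\iota(\Gamma\setminus\partial\Gamma)$. *)

theory Defs
  imports
    "HOL-Analysis.Analysis"
    "HOL-Library.Poly_Mapping"
    "HOL-Algebra.Algebraic_Closure_Type"
    "Graph_Theory.Graph_Theory"
begin

section \<open>Valued fields\<close>

text \<open>
  \<open>'o\<close> is a discrete valuation ring with normalised valuation \<open>v\<close>, and it is complete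
  for \<open>v\<close>.  Its fraction field is \<open>'o fract\<close> and the algebraic closure of the latter is
  \<open>'o fract alg_closure\<close>.
\<close>

definition discrete_valuation_ring :: "('o::idom \<Rightarrow> enat) \<Rightarrow> bool" where
  "discrete_valuation_ring v \<longleftrightarrow>
     (\<forall>x. v x = \<infinity> \<longleftrightarrow> x = 0) \<and>
     (\<forall>x y. v (x * y) = v x + v y) \<and>
     (\<forall>x y. min (v x) (v y) \<le> v (x + y)) \<and>
     (\<forall>x. v x = 0 \<longrightarrow> x dvd 1) \<and>
     (\<exists>x. v x = 1)"

definition valuation_complete :: "('o::idom \<Rightarrow> enat) \<Rightarrow> bool" where
  "valuation_complete v \<longleftrightarrow>
     (\<forall>s :: nat \<Rightarrow> 'o.
        (\<forall>N::nat. \<exists>M. \<forall>i\<ge>M. \<forall>j\<ge>M. enat N \<le> v (s i - s j)) \<longrightarrow>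
        (\<exists>l. \<forall>N::nat. \<exists>M. \<forall>i\<ge>M. enat N \<le> v (s i - l)))"

definition residue_field :: "('o::idom \<Rightarrow> enat) \<Rightarrow> 'o set ring" where
  "residue_field v = (ring_of_type_algebra :: 'o ring) Quot {x. 0 < v x}"

text \<open>
  The value \<open>\<infinity>\<close> at \<open>0\<close> is left implicit: \<open>w 0\<close> is unconstrained and never used.
\<close>

definition extended_valuation ::
    "('o::idom \<Rightarrow> enat) \<Rightarrow> ('o fract alg_closure \<Rightarrow> rat) \<Rightarrow> bool" where
  "extended_valuation v w \<longleftrightarrow>
     (\<forall>x y. x \<noteq> 0 \<longrightarrow> y \<noteq> 0 \<longrightarrow> w (x * y) = w x + w y) \<and>
     (\<forall>x y. x \<noteq> 0 \<longrightarrow> y \<noteq> 0 \<longrightarrow> x + y \<noteq> 0 \<longrightarrow> min (w x) (w y) \<le> w (x + y)) \<and>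
     (\<forall>a. a \<noteq> 0 \<longrightarrow> w (to_ac (Fraction_Field.Fract a 1)) = of_nat (the_enat (v a)))"


section \<open>Lattices and tori\<close>

text \<open>
  \<open>\<Lambda> = int ^ 'n\<close>; the dual lattice is identified with \<open>int ^ 'n\<close> by the standard pairing, and
  \<open>\<rat> \<otimes> \<Lambda> = rat ^ 'n\<close>.
\<close>

definition rat_vec :: "int ^ 'n \<Rightarrow> rat ^ 'n" where
  "rat_vec s = (\<chi> i. of_int (s $ i))"

definition pairing :: "int ^ 'n \<Rightarrow> 'a::comm_ring_1 ^ 'n \<Rightarrow> 'a" where
  "pairing l s = (\<Sum>i\<in>UNIV. of_int (l $ i) * s $ i)"

definition primitive_vec :: "int ^ 'n \<Rightarrow> bool" where
  "primitive_vec r \<longleftrightarrow> r \<noteq> 0 \<and> (\<forall>k s. r = k *s s \<longrightarrow> \<bar>k\<bar> = 1)"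

definition primitive_part :: "int ^ 'n \<Rightarrow> int ^ 'n" where
  "primitive_part s = (THE r. primitive_vec r \<and> (\<exists>d>0. s = d *s r))"

text \<open>A point \<open>x\<close> of the torus is a homomorphism \<open>\<Lambda>\<^sup>\<or> \<rightarrow> \<bbbK>\<^sup>*\<close>, so the character
  \<open>\<chi>\<^sup>l\<close> takes the value \<open>x l\<close> at \<open>x\<close>.\<close>

definition torus :: "(int ^ 'n \<Rightarrow> 'k::field) set" where
  "torus = {x. (\<forall>l. x l \<noteq> 0) \<and> (\<forall>l l'. x (l + l') = x l * x l')}"

definition torus_valuation :: "('k::field \<Rightarrow> rat) \<Rightarrow> (int ^ 'n \<Rightarrow> 'k) \<Rightarrow> rat ^ 'n" where
  "torus_valuation w x = (THE q. \<forall>l. pairing l q = w (x l))"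


section \<open>Smooth connected curves over an algebraically closed field\<close>

text \<open>
  Curves are abstract nonsingular curves in the sense of Hartshorne, Section I.6.  A smooth complete
  connected curve over the algebraically closed field \<open>'k\<close> is given by its function field \<open>F\<close>, and
  its points are the normalised discrete valuations of \<open>F\<close> that are trivial on \<open>'k\<close>.  A smooth
  connected curve is a subset \<open>U\<close> of such a set of points with finite complement.

  Every function field of one variable over \<open>'k\<close> embeds over \<open>'k\<close> into the algebraic closure of
  the rational function field in one variable, so function fields are taken to be subfields of
  that closure.  This loses no isomorphism class of curves.
\<close>

type_synonym 'k universal = "'k poly fract alg_closure"

type_synonym 'k point = "'k universal \<Rightarrow> int"

definition const :: "'k::field \<Rightarrow> 'k universal" where
  "const c = to_ac (Fraction_Field.Fract [:c:] 1)"

definition eval_const :: "'k::field poly \<Rightarrow> 'k universal \<Rightarrow> 'k universal" where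
  "eval_const p x = Polynomial.poly (map_poly const p) x"

definition simple_extension :: "'k::field universal \<Rightarrow> 'k universal set" where
  "simple_extension x = {eval_const p x / eval_const q x | p q. eval_const q x \<noteq> 0}"

definition function_field :: "'k::field universal set \<Rightarrow> bool" where
  "function_field F \<longleftrightarrow>
     range const \<subseteq> F \<and>
     (\<forall>f\<in>F. \<forall>g\<in>F. f + g \<in> F \<and> f * g \<in> F) \<and>
     (\<forall>f\<in>F. - f \<in> F \<and> inverse f \<in> F) \<and>
     (\<exists>x\<in>F. (\<forall>p. p \<noteq> 0 \<longrightarrow> eval_const p x \<noteq> 0) \<and>
        (\<exists>B. finite B \<and> B \<subseteq> F \<and>
           (\<forall>f\<in>F. \<exists>a. (\<forall>b\<in>B. a b \<in> simple_extension x) \<and> f = (\<Sum>b\<in>B. a b * b))))"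

text \<open>
  \<open>P f\<close> is the order of vanishing of \<open>f\<close> at the point \<open>P\<close>.  The convention \<open>P f = 0\<close> for
  \<open>f = 0\<close> and for \<open>f\<close> outside \<open>F\<close> makes distinct points distinct functions.
\<close>

definition smooth_completion :: "'k::field universal set \<Rightarrow> 'k point set" where
  "smooth_completion F = {P.
     (\<forall>f\<in>F. \<forall>g\<in>F. f \<noteq> 0 \<longrightarrow> g \<noteq> 0 \<longrightarrow> P (f * g) = P f + P g) \<and>
     (\<forall>f\<in>F. \<forall>g\<in>F. f \<noteq> 0 \<longrightarrow> g \<noteq> 0 \<longrightarrow> f + g \<noteq> 0 \<longrightarrow> min (P f) (P g) \<le> P (f + g)) \<and>
     (\<forall>c. c \<noteq> 0 \<longrightarrow> P (const c) = 0) \<and>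
     (\<exists>f\<in>F. f \<noteq> 0 \<and> P f = 1) \<and>
     (\<forall>f. f = 0 \<or> f \<notin> F \<longrightarrow> P f = 0)}"

definition smooth_curve :: "'k::field universal set \<Rightarrow> 'k point set \<Rightarrow> bool" where
  "smooth_curve F U \<longleftrightarrow>
     function_field F \<and> U \<subseteq> smooth_completion F \<and> finite (smooth_completion F - U)"

text \<open>
  Riemann's definition of the genus as the maximum of \<open>deg D - dim L(D) + 1\<close> over all divisors \<open>D\<close>.
  All points have degree one since \<open>'k\<close> is algebraically closed.
\<close>

definition divisors :: "'k::field universal set \<Rightarrow> ('k point \<Rightarrow> int) set" where
  "divisors F = {D. finite {P. D P \<noteq> 0} \<and> {P. D P \<noteq> 0} \<subseteq> smooth_completion F}"

definition riemann_roch_space ::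
    "'k::field universal set \<Rightarrow> ('k point \<Rightarrow> int) \<Rightarrow> 'k universal set" where
  "riemann_roch_space F D = {f \<in> F. f = 0 \<or> (\<forall>P\<in>smooth_completion F. P f + D P \<ge> 0)}"

lemma vector_space_universal: "vector_space (\<lambda>(c :: 'k::field) f. const c * f)"
proof -
  have "const (a + b) = const a + const b" "const (a * b) = const a * const b"
       "const (1 :: 'k) = 1" for a b :: 'k
    by (simp_all add: const_def One_fract_def one_pCons mult.commute flip: to_ac_add to_ac_mult)
  then show ?thesis
    by unfold_locales (simp_all add: algebra_simps)
qed

definition genus :: "'k::field universal set \<Rightarrow> int" where
  "genus F =
     (SUP D\<in>divisors F. (\<Sum>P | D P \<noteq> 0. D P)
        - int (vector_space.dim (\<lambda>c f. const c * f) (riemann_roch_space F D)) + 1)"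

definition regular_functions ::
    "'k::field universal set \<Rightarrow> 'k point set \<Rightarrow> 'k universal set" where
  "regular_functions F U = {f \<in> F. f = 0 \<or> (\<forall>P\<in>U. P f \<ge> 0)}"

definition has_value :: "'k::field point \<Rightarrow> 'k universal \<Rightarrow> 'k \<Rightarrow> bool" where
  "has_value P f c \<longleftrightarrow> f = const c \<or> P (f - const c) > 0"


section \<open>Maps from curves to tori\<close>

definition is_pullback ::
    "'k::field universal set \<Rightarrow> 'k point set \<Rightarrow> ('k point \<Rightarrow> int ^ 'n \<Rightarrow> 'k) \<Rightarrow>
     int ^ 'n \<Rightarrow> 'k universal \<Rightarrow> bool" where
  "is_pullback F U \<phi> l f \<longleftrightarrow> f \<in> regular_functions F U \<and> (\<forall>P\<in>U. has_value P f (\<phi> P l))"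

definition torus_map ::
    "'k::field universal set \<Rightarrow> 'k point set \<Rightarrow> ('k point \<Rightarrow> int ^ 'n \<Rightarrow> 'k) \<Rightarrow> bool" where
  "torus_map F U \<phi> \<longleftrightarrow> (\<forall>P\<in>U. \<phi> P \<in> torus) \<and> (\<forall>l. \<exists>f. is_pullback F U \<phi> l f)"

definition extends_to ::
    "'k::field universal set \<Rightarrow> 'k point set \<Rightarrow> ('k point \<Rightarrow> int ^ 'n \<Rightarrow> 'k) \<Rightarrow> 'k point \<Rightarrow> bool" where
  "extends_to F U \<phi> x \<longleftrightarrow> (\<exists>\<psi>. torus_map F (insert x U) \<psi> \<and> (\<forall>P\<in>U. \<psi> P = \<phi> P))"

text \<open>\<open>\<chi>\<^sup>l \<circ> \<phi>\<close> as an element of the function field.\<close>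

definition pullback ::
    "'k::field universal set \<Rightarrow> 'k point set \<Rightarrow> ('k point \<Rightarrow> int ^ 'n \<Rightarrow> 'k) \<Rightarrow>
     int ^ 'n \<Rightarrow> 'k universal" where
  "pullback F U \<phi> l = (THE f. is_pullback F U \<phi> l f)"

definition order_vec ::
    "'k::field universal set \<Rightarrow> 'k point set \<Rightarrow> ('k point \<Rightarrow> int ^ 'n \<Rightarrow> 'k) \<Rightarrow> 'k point \<Rightarrow> int ^ 'n" where
  "order_vec F U \<phi> x = (THE s. \<forall>l. pairing l s = x (pullback F U \<phi> l))"

definition curve_degree ::
    "'k::field universal set \<Rightarrow> 'k point set \<Rightarrow> ('k point \<Rightarrow> int ^ 'n \<Rightarrow> 'k) \<Rightarrow> (int ^ 'n) set" where
  "curve_degree F U \<phi> =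
     (let \<sigma> = order_vec F U \<phi>; \<rho> = (\<lambda>x. primitive_part (\<sigma> x)) in
      (\<lambda>r. \<Sum>x | x \<in> smooth_completion F - U \<and> \<rho> x = r. \<sigma> x) ` \<rho> ` (smooth_completion F - U))"

definition Trop :: "('k::field \<Rightarrow> rat) \<Rightarrow> 'k point set \<Rightarrow> ('k point \<Rightarrow> int ^ 'n \<Rightarrow> 'k) \<Rightarrow> (rat ^ 'n) set" where
  "Trop w U \<phi> = (\<lambda>P. torus_valuation w (\<phi> P)) ` U"


section \<open>Zero tension curves\<close>

text \<open>
  A finite graph, possibly with loops and multiple edges, is a finite multidigraph: the
  orientation of each edge is an arbitrary choice that serves to parameterize it.
\<close>

definition boundary :: "('a, 'b) pre_digraph \<Rightarrow> 'a set" where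
  "boundary G = {u \<in> verts G. in_degree G u + out_degree G u = 1}"

text \<open>
  The first Betti number is the dimension of \<open>H\<^sub>1(\<Gamma>, \<rat>)\<close>, the kernel of the cellular boundary map.
\<close>

definition cycle_space :: "('a, 'b) pre_digraph \<Rightarrow> ('b \<Rightarrow>\<^sub>0 rat) set" where
  "cycle_space G = {c. Poly_Mapping.keys c \<subseteq> arcs G \<and>
     (\<forall>u\<in>verts G. (\<Sum>e\<in>in_arcs G u. Poly_Mapping.lookup c e) - (\<Sum>e\<in>out_arcs G u. Poly_Mapping.lookup c e) = 0)}"

lemma vector_space_chains: "vector_space (\<lambda>(a :: rat). Poly_Mapping.map ((*) a) :: ('b \<Rightarrow>\<^sub>0 rat) \<Rightarrow> _)"
proof -
  have "Poly_Mapping.lookup (Poly_Mapping.map ((*) a) c) e = a * Poly_Mapping.lookup c e"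
    for a and c :: "'b \<Rightarrow>\<^sub>0 rat" and e
    by (simp add: Poly_Mapping.map.rep_eq when_def)
  then show ?thesis
    by unfold_locales (auto intro!: poly_mapping_eqI simp: lookup_add algebra_simps)
qed

definition first_betti_number :: "('a, 'b) pre_digraph \<Rightarrow> nat" where
  "first_betti_number G = vector_space.dim (\<lambda>a. Poly_Mapping.map ((*) a)) (cycle_space G)"

text \<open>
  Rational points of \<open>\<Gamma>\<close> away from \<open>\<partial>\<Gamma>\<close>.  As curves are taken up to reparameterization of edges, the
  interior of an edge is identified with a rational interval, oriented from tail to head, on which
  the map to \<open>\<rat> \<otimes> \<Lambda>\<close> is affine; the interval is unbounded on the sides of the endpoints in \<open>\<partial>\<Gamma>\<close>.
\<close>

datatype ('a, 'b) graph_point = Vertex 'a | Edge_Point 'b rat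

definition edge_interval :: "('a, 'b) pre_digraph \<Rightarrow> 'b \<Rightarrow> rat set" where
  "edge_interval G e =
     (if tail G e \<in> boundary G then (if head G e \<in> boundary G then UNIV else {..<0})
      else (if head G e \<in> boundary G then {0<..} else {0<..<1}))"

definition points_off_boundary :: "('a, 'b) pre_digraph \<Rightarrow> ('a, 'b) graph_point set" where
  "points_off_boundary G = Vertex ` (verts G - boundary G) \<union>
     {Edge_Point e t | e t. e \<in> arcs G \<and> t \<in> edge_interval G e}"

text \<open>
  A rational segment, ray or line is parallel to a lattice vector, so it has slope in \<open>\<Lambda>\<close>.
\<close>

definition affine_on_edge ::
    "('a, 'b) pre_digraph \<Rightarrow> (('a, 'b) graph_point \<Rightarrow> rat ^ 'n) \<Rightarrow> 'b \<Rightarrow> bool" where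
  "affine_on_edge G \<iota> e \<longleftrightarrow>
     (if tail G e \<in> boundary G then
        (if head G e \<in> boundary G
         then \<exists>p b. b \<noteq> 0 \<and> (\<forall>t. \<iota> (Edge_Point e t) = p + t *s b)
         else \<exists>b. b \<noteq> 0 \<and> (\<forall>t<0. \<iota> (Edge_Point e t) = \<iota> (Vertex (head G e)) + t *s b))
      else
        (if head G e \<in> boundary G
         then \<exists>b. b \<noteq> 0 \<and> (\<forall>t>0. \<iota> (Edge_Point e t) = \<iota> (Vertex (tail G e)) + t *s b)
         else \<forall>t. 0 < t \<longrightarrow> t < 1 \<longrightarrow>
           \<iota> (Edge_Point e t) = (1 - t) *s \<iota> (Vertex (tail G e)) + t *s \<iota> (Vertex (head G e))))"

text \<open>The minimal lattice vector parallel to \<open>\<iota>(e)\<close> pointing from tail to head.\<close>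

definition edge_direction ::
    "('a, 'b) pre_digraph \<Rightarrow> (('a, 'b) graph_point \<Rightarrow> rat ^ 'n) \<Rightarrow> 'b \<Rightarrow> int ^ 'n" where
  "edge_direction G \<iota> e =
     (if \<forall>s\<in>edge_interval G e. \<forall>t\<in>edge_interval G e. \<iota> (Edge_Point e s) = \<iota> (Edge_Point e t)
      then 0
      else (THE r. primitive_vec r \<and>
        (\<forall>s\<in>edge_interval G e. \<forall>t\<in>edge_interval G e. s < t \<longrightarrow>
           (\<exists>c>0. \<iota> (Edge_Point e t) - \<iota> (Edge_Point e s) = c *s rat_vec r))))"

text \<open>
  Loops are contracted to points, hence have direction \<open>0\<close> and need no case of their own.
\<close>

definition rho ::
    "('a, 'b) pre_digraph \<Rightarrow> (('a, 'b) graph_point \<Rightarrow> rat ^ 'n) \<Rightarrow> 'a \<Rightarrow> 'b \<Rightarrow> int ^ 'n" where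
  "rho G \<iota> u e = (if tail G e = u then edge_direction G \<iota> e else - edge_direction G \<iota> e)"

definition edges_at :: "('a, 'b) pre_digraph \<Rightarrow> 'a \<Rightarrow> 'b set" where
  "edges_at G u = in_arcs G u \<union> out_arcs G u"

definition zero_tension_curve ::
    "('a, 'b) pre_digraph \<Rightarrow> (('a, 'b) graph_point \<Rightarrow> rat ^ 'n) \<Rightarrow> ('b \<Rightarrow> nat) \<Rightarrow> bool" where
  "zero_tension_curve G \<iota> m \<longleftrightarrow>
     fin_digraph G \<and>
     (\<forall>e\<in>arcs G. affine_on_edge G \<iota> e) \<and>
     (\<forall>e\<in>arcs G. m e > 0) \<and>
     (\<forall>u\<in>verts G - boundary G. (\<Sum>e\<in>edges_at G u. int (m e) *s rho G \<iota> u e) = 0)"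

definition tropical_degree ::
    "('a, 'b) pre_digraph \<Rightarrow> (('a, 'b) graph_point \<Rightarrow> rat ^ 'n) \<Rightarrow> ('b \<Rightarrow> nat) \<Rightarrow> (int ^ 'n) set" where
  "tropical_degree G \<iota> m =
     (let D = {- rho G \<iota> u e | u e. u \<in> boundary G \<and> e \<in> edges_at G u};
          mult = (\<lambda>l. \<Sum>e | \<exists>u\<in>boundary G. e \<in> edges_at G u \<and> - rho G \<iota> u e = l. int (m e))
      in (\<lambda>l. mult l *s l) ` D)"

end

theory Submission
  imports Defs
begin

text \<open>
  Root the tree \<open>\<Gamma>\<close> at an interior vertex and let \<open>s\<^sub>i\<close> be the outward weighted direction of the
  leaf \<open>i\<close>.  The curve is the projective line punctured at points \<open>a\<^sub>i\<close> indexed by the leaves, with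
  \<open>\<phi>(z) = c \<Prod>(z - a\<^sub>i)^s\<^sub>i\<close>.  The residue field is infinite, so balls of the field can be placed in
  the same configuration as the vertices of \<open>\<Gamma>\<close>: the vertex \<open>v\<close> at distance \<open>D v\<close> from the root
  corresponds to a ball of radius \<open>D v\<close> with centre \<open>a v\<close>, and the balls of the children of \<open>v\<close> lie
  in distinct residue classes of the ball of \<open>v\<close>.  The tension being zero, summation by parts turns
  \<open>\<Sum> w(z - a\<^sub>i) s\<^sub>i\<close> into a sum over all edges.  Only the edges on the path from the root to the
  smallest ball containing \<open>z\<close> contribute, and their contributions add up to the displacement
  along this path, so \<open>w(\<phi>(z))\<close> is the point of \<open>\<iota>(\<Gamma>)\<close> at its end.
\<close>


section \<open>Valuations on algebraically closed fields\<close>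

text \<open>Edge lengths are measured in units of the weighted direction: a step of length t moves
  by t times \<open>s\<close>. With this normalisation the multiplicities go into the radii, and the
  weighted end vectors can serve as exponents. The lengths are arbitrary positive rationals, so
  radii of all rational valuations are needed; roots of a uniformizer supply them. The exponents add
  up to zero, so infinity is not a puncture. There the map takes the constant value c, whose
  valuation is chosen to be the position of the root. A contracted edge has vector 0 and moves
  nothing, but it still gets a positive length, which keeps the balls strictly nested. Ends with
  equal direction get separate punctures, since they may leave the tree at different places; the
  degree only regroups them. A tree all of whose vertices are ends is a single line and has no
  interior vertex to start from, so a root is supplied artificially. Points of a curve are abstract
  discrete valuations. Those of k(z) have to be classified before infinity, the punctures and the
  genus can be handled.\<close>

locale valued_field =
  fixes w :: "'k::field \<Rightarrow> rat"
  assumes w_mult: "x \<noteq> 0 \<Longrightarrow> y \<noteq> 0 \<Longrightarrow> w (x * y) = w x + w y"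
    and w_add: "x \<noteq> 0 \<Longrightarrow> y \<noteq> 0 \<Longrightarrow> x + y \<noteq> 0 \<Longrightarrow> min (w x) (w y) \<le> w (x + y)"
begin

lemma w_one [simp]: "w 1 = 0"
  using w_mult[of 1 1] by simp

lemma w_minus [simp]: "w (- x) = w x"
proof (cases "x = 0")
  case False
  have "w (- 1) = 0"
    using w_mult[of "-1" "-1"] by simp
  then show ?thesis
    using w_mult[of "-1" x] False by simp
qed simp

lemma w_diff_commute: "w (x - y) = w (y - x)"
  using w_minus[of "x - y"] by simp

lemma w_divide: "x \<noteq> 0 \<Longrightarrow> y \<noteq> 0 \<Longrightarrow> w (x / y) = w x - w y"
  using w_mult[of "x / y" y] by simp

lemma w_power: "x \<noteq> 0 \<Longrightarrow> w (x ^ n) = of_nat n * w x"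
  by (induction n) (simp_all add: w_mult algebra_simps)

lemma w_power_int: "x \<noteq> 0 \<Longrightarrow> w (x powi k) = of_int k * w x"
  using w_divide[of 1 "x ^ nat (- k)"]
  by (cases k rule: int_cases2) (simp_all add: w_power power_int_minus field_simps)

lemma w_prod: "(\<And>i. i \<in> A \<Longrightarrow> f i \<noteq> 0) \<Longrightarrow> w (\<Prod>i\<in>A. f i) = (\<Sum>i\<in>A. w (f i))"
  by (induction A rule: infinite_finite_induct) (simp_all add: w_mult)

lemma w_triangle:
  assumes "x \<noteq> y" "y \<noteq> z" "x \<noteq> z"
  shows "min (w (x - y)) (w (y - z)) \<le> w (x - z)"
  using w_add[of "x - y" "y - z"] assms by simp

text \<open>Of the three sides of an ultrametric triangle the two longest are equal. The alternative
  \<open>y = z\<close> stands for an infinite value of \<open>w (y - z)\<close>, because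
  \<open>w 0\<close> is unconstrained.\<close>

lemma w_isosceles:
  assumes "x \<noteq> y" "y = z \<or> w (x - y) < w (y - z)"
  shows "x \<noteq> z \<and> w (x - z) = w (x - y)"
proof (cases "y = z")
  case False
  then have less: "w (x - y) < w (y - z)"
    using assms by simp
  have "x \<noteq> z"
    using less w_diff_commute[of x y] by auto
  moreover have "min (w (x - z)) (w (z - y)) \<le> w (x - y)"
    using w_triangle[of x z y] assms False \<open>x \<noteq> z\<close> by simp
  moreover have "min (w (x - y)) (w (y - z)) \<le> w (x - z)"
    using w_triangle[of x y z] assms False \<open>x \<noteq> z\<close> by simp
  ultimately show ?thesis
    using less w_diff_commute[of y z] by (auto simp: min_def split: if_splits)
qed (use assms in auto)

end

locale alg_closed_valued_field = valued_field w
  for w :: "'k::alg_closed_field \<Rightarrow> rat" +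
  assumes w_uniformizer: "\<exists>x. x \<noteq> 0 \<and> w x = 1"
begin

text \<open>For q = m/n, an n-th root of an element of valuation 1 is raised to the power m.\<close>

lemma w_surj: "\<exists>x. x \<noteq> 0 \<and> w x = q"
proof -
  obtain b where b: "b \<noteq> 0" "w b = 1"
    using w_uniformizer by blast
  obtain m n where q: "q = of_int m / of_int n" "n > 0"
    by (metis Fract_of_int_quotient Rat_cases)
  obtain x where x: "x ^ nat n = b"
    using nth_root_exists[of "nat n" b] q by auto
  then have "x \<noteq> 0"
    using b q by (auto simp: zero_power)
  moreover have "of_int n * w x = 1"
    using w_power[OF \<open>x \<noteq> 0\<close>, of "nat n"] x b q by simp
  then have "w x = 1 / of_int n"
    using q by (simp add: field_simps)
  then have "w (x powi m) = q"
    using q \<open>x \<noteq> 0\<close> by (simp add: w_power_int)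
  ultimately show ?thesis
    by (metis power_int_not_zero)
qed

text \<open>A root of \<open>\<Prod>x\<in>A. (X - x) + 1\<close> is integral and lies in no residue class of \<open>A\<close>; so the
  residue field is infinite.\<close>

lemma new_residue_class:
  assumes "finite A" "A \<noteq> {}" and int: "\<And>x. x \<in> A \<Longrightarrow> x = 0 \<or> 0 \<le> w x"
  shows "\<exists>z. (z = 0 \<or> 0 \<le> w z) \<and> z \<notin> A \<and> (\<forall>x\<in>A. w (z - x) = 0)"
proof -
  let ?P = "\<Prod>x\<in>A. [:- x, 1:]"
  have deg: "Polynomial.degree ?P = card A"
    using degree_prod_eq_sum_degree[of A "\<lambda>x. [:- x, 1:]"] by simp
  have "Polynomial.degree (?P + 1) = card A"
    using deg assms by (subst degree_add_eq_left) (auto simp: card_gt_0_iff)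
  then obtain z where "poly (?P + 1) z = 0"
    using alg_closed_imp_poly_has_root[of "?P + 1"] assms by (auto simp: card_gt_0_iff)
  then have prod: "(\<Prod>x\<in>A. z - x) = - 1"
    by (simp add: poly_prod eq_neg_iff_add_eq_0)
  have nin: "z \<notin> A"
    using prod prod_zero[OF \<open>finite A\<close>, of "\<lambda>x. z - x"] by auto
  \<comment> \<open>The factors multiply to -1, so their valuations add up to 0; it remains to see
    that each of them is nonnegative.\<close>
  then have sum: "(\<Sum>x\<in>A. w (z - x)) = 0"
    using w_prod[of A "\<lambda>x. z - x"] prod by force
  have z: "z = 0 \<or> 0 \<le> w z"
  proof (rule ccontr)
    assume neg: "\<not> ?thesis"
    \<comment> \<open>A nonintegral z dominates every element of \<open>A\<close>, so the sum would
      be \<open>card A\<close> times a negative number.\<close>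
    have "w (z - x) = w z" if "x \<in> A" for x
      using w_isosceles[of z 0 x] int[OF that] neg by auto
    then show False
      using sum neg assms by simp
  qed
  have "0 \<le> w (z - x)" if "x \<in> A" for x
  proof -
    have "z \<noteq> x"
      using nin that by blast
    then show ?thesis
      using w_triangle[of z 0 x] int[OF that] z by (cases "z = 0"; cases "x = 0") auto
  qed
  then show ?thesis
    using sum z nin sum_nonneg_eq_0_iff[OF \<open>finite A\<close>, of "\<lambda>x. w (z - x)"] by auto
qed

text \<open>The class of 0 is avoided too: it belongs to the centre of the parent ball, from which
  the children have to be separated as well.\<close>

lemma distinct_residue_classes:
  assumes "finite N"
  shows "\<exists>y. \<forall>c\<in>N. y c \<noteq> 0 \<and> w (y c) = 0 \<and> (\<forall>c'\<in>N. c \<noteq> c' \<longrightarrow> y c \<noteq> y c' \<and> w (y c - y c') = 0)"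
  using assms
proof (induction N)
  case (insert d N)
  then obtain y where y:
    "\<And>c. c \<in> N \<Longrightarrow> y c \<noteq> 0 \<and> w (y c) = 0 \<and> (\<forall>c'\<in>N. c \<noteq> c' \<longrightarrow> y c \<noteq> y c' \<and> w (y c - y c') = 0)"
    by blast
  obtain z where z: "z \<notin> insert 0 (y ` N)" "\<forall>x\<in>insert 0 (y ` N). w (z - x) = 0"
    using new_residue_class[of "insert 0 (y ` N)"] insert.hyps y by fastforce
  show ?case
    using y z insert.hyps w_diff_commute[of z] by (intro exI[of _ "y(d := z)"]) force
qed simp

end


section \<open>Realising a rooted tree by balls\<close>

text \<open>\<open>N\<close> is the set of vertices other than the root \<open>r\<close>, and \<open>L\<close> is the set of leaves.\<close>

locale rooted_tree =
  fixes N :: "'c set" and r :: 'c and p :: "'c \<Rightarrow> 'c" and rk :: "'c \<Rightarrow> nat" and L :: "'c set"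
  assumes finite_N: "finite N"
    and r_notin: "r \<notin> N"
    and L_sub: "L \<subseteq> N"
    and parent: "c \<in> N \<Longrightarrow> p c \<in> insert r (N - L)"
    and rk_root: "rk r = 0"
    and rk_Suc: "c \<in> N \<Longrightarrow> rk c = Suc (rk (p c))"
begin

lemma rk_less: "c \<in> N \<Longrightarrow> rk (p c) < rk c"
  using rk_Suc by simp

text \<open>\<open>g n v\<close> unrolls n parent steps from v and puts x at the end. The rank
  counts the steps to the root, so n = \<open>rk v\<close> is the right depth at v.\<close>

lemma tree_recursion: "\<exists>f. f r = x \<and> (\<forall>c\<in>N. f c = F c (f (p c)))"
proof -
  define g where "g = rec_nat (\<lambda>v. x) (\<lambda>n f v. F v (f (p v)))"
  have g: "g 0 = (\<lambda>v. x)" "g (Suc n) = (\<lambda>v. F v (g n (p v)))" for n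
    by (simp_all add: g_def)
  show ?thesis
    by (rule exI[of _ "\<lambda>v. g (rk v) v"]) (auto simp: g rk_root rk_Suc)
qed

end

text \<open>\<open>D\<close> measures the distance from the root up to an additive constant,
  \<open>s c\<close> is the weighted direction of the edge from \<open>p c\<close> to c, and
  \<open>q\<close> gives the positions of vertices. Edges to leaves are unbounded rays, so lengths
  and end positions are prescribed on \<open>N - L\<close>.\<close>

locale weighted_tree = rooted_tree +
  fixes D :: "'c \<Rightarrow> rat" and s :: "'c \<Rightarrow> rat ^ 'n" and q :: "'c \<Rightarrow> rat ^ 'n"
  assumes D_less: "c \<in> N - L \<Longrightarrow> D (p c) < D c"
    and balance: "v \<in> N - L \<Longrightarrow> s v = (\<Sum>c | c \<in> N \<and> p c = v. s c)"
    and balance_root: "(\<Sum>c | c \<in> N \<and> p c = r. s c) = 0"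
    and q_step: "c \<in> N - L \<Longrightarrow> q c = q (p c) + (D c - D (p c)) *s s c"
begin

text \<open>Edges are taken half open: the start of an edge is the end of its parent edge or the
  root, so t = 0 is left out and only \<open>q r\<close> is added.\<close>

definition image :: "(rat ^ 'n) set" where
  "image = insert (q r)
     {q (p c) + t *s s c | c t. c \<in> N \<and> 0 < t \<and> (c \<in> L \<or> t \<le> D c - D (p c))}"

text \<open>Summation by parts. When the terms \<open>g (p c) *s s c\<close> are grouped by parent,
  zero tension turns the group at v into \<open>g v *s s v\<close> and the group at the root into 0.
  The interior terms cancel and the leaves remain.\<close>

lemma sum_leaves:
  fixes g :: "'c \<Rightarrow> rat"
  shows "(\<Sum>i\<in>L. g i *s s i) = (\<Sum>c\<in>N. (g c - g (p c)) *s s c)"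
proof -
  have "(\<Sum>c\<in>N. g (p c) *s s c) = (\<Sum>v\<in>insert r (N - L). \<Sum>c | c \<in> N \<and> p c = v. g (p c) *s s c)"
    using parent finite_N by (intro sum.group[symmetric]) auto
  also have "\<dots> = (\<Sum>v\<in>insert r (N - L). g v *s (\<Sum>c | c \<in> N \<and> p c = v. s c))"
    by (intro sum.cong refl) (simp add: vec.scale_sum_right)
  also have "\<dots> = (\<Sum>v\<in>N - L. g v *s s v)"
    using finite_N r_notin balance balance_root by simp
  finally have "(\<Sum>c\<in>N. (g c - g (p c)) *s s c) = (\<Sum>c\<in>N. g c *s s c) - (\<Sum>v\<in>N - L. g v *s s v)"
    by (simp add: vector_sub_rdistrib sum_subtractf)
  then show ?thesis
    using sum.subset_diff[OF L_sub finite_N, of "\<lambda>c. g c *s s c"] by simp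
qed

end

text \<open>The vertex \<open>v\<close> other than a leaf corresponds to the closed ball of radius \<open>D v\<close> around \<open>a v\<close>;
  a larger value of \<open>D\<close> means a smaller ball.\<close>

locale ball_tree = weighted_tree N r p rk L D s q + alg_closed_valued_field w
  for N :: "'c set" and r p rk L D and s q :: "'c \<Rightarrow> rat ^ 'n"
    and w :: "'k::alg_closed_field \<Rightarrow> rat" +
  fixes a :: "'c \<Rightarrow> 'k"
  assumes a_parent: "c \<in> N \<Longrightarrow> a c \<noteq> a (p c) \<and> w (a c - a (p c)) = D (p c)"
    and a_sibling: "c \<in> N \<Longrightarrow> c' \<in> N \<Longrightarrow> p c = p c' \<Longrightarrow> c \<noteq> c' \<Longrightarrow>
      a c \<noteq> a c' \<and> w (a c - a c') = D (p c)"
begin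

text \<open>Membership says that z lies in the residue class of \<open>a c\<close> inside the ball
  of \<open>p c\<close>; in the tree, the path from the root towards z enters the edge ending at
  c.\<close>

definition chain :: "'k \<Rightarrow> 'c set" where
  "chain z = {c \<in> N. z = a c \<or> D (p c) < w (z - a c)}"

text \<open>The level \<open>w (z - a c)\<close> of the smallest ball around \<open>a c\<close>
  containing z, truncated at \<open>D c\<close>. A leaf is infinitely far away, so there is no
  truncation there; at other vertices \<open>z = a c\<close> counts as an infinite
  valuation.\<close>

definition height :: "'k \<Rightarrow> 'c \<Rightarrow> rat" where
  "height z c = (if c \<in> L then w (z - a c) else if z = a c then D c else min (D c) (w (z - a c)))"

section \<open>The nested balls containing a point\<close>

lemma chain_imp_ball:
  assumes "c \<in> chain z"
  shows "z = a (p c) \<or> D (p c) \<le> w (z - a (p c))"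
  using assms a_parent[of c] w_triangle[of z "a c" "a (p c)"] unfolding chain_def
  by (cases "z = a c") auto

text \<open>A residue class inside the ball of \<open>p c\<close> is contained in that ball, which
  is strictly smaller than the ball of its own parent.\<close>

lemma chain_parent:
  assumes "c \<in> chain z" "p c \<noteq> r"
  shows "p c \<in> chain z"
  using chain_imp_ball[OF assms(1)] assms parent[of c] D_less[of "p c"] unfolding chain_def by auto

lemma chain_sibling:
  assumes "c \<in> chain z" "c' \<in> chain z" "p c = p c'"
  shows "c = c'"
proof (rule ccontr)
  assume "c \<noteq> c'"
  then have "a c \<noteq> a c' \<and> w (a c - a c') = D (p c)"
    using a_sibling assms unfolding chain_def by auto
  moreover from this have "z \<noteq> a c" "z \<noteq> a c'"
    using assms w_diff_commute[of "a c" "a c'"] unfolding chain_def by auto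
  ultimately show False
    using assms w_triangle[of "a c" z "a c'"] w_diff_commute[of "a c" z] \<open>c \<noteq> c'\<close>
    unfolding chain_def by auto
qed

text \<open>By induction two members of equal rank have the same parent, and then z lies in the
  residue classes of both, so they coincide. Together with closure under parents this makes the
  chain a path that starts at the root.\<close>

lemma chain_rk_inj:
  assumes "c \<in> chain z" "c' \<in> chain z" "rk c = rk c'"
  shows "c = c'"
  using assms
proof (induction "rk c" arbitrary: c c')
  case 0
  then show ?case
    using rk_Suc[of c] by (simp add: chain_def)
next
  case (Suc n)
  have N: "c \<in> N" "c' \<in> N"
    using Suc.prems by (simp_all add: chain_def)
  have rk: "rk (p c) = n" "rk (p c') = n"
    using Suc.hyps(2) Suc.prems N rk_Suc by (metis Suc_inject)+
  have pos: "rk v > 0" if "v \<in> N" for v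
    using rk_Suc[OF that] by simp
  have "p c = p c'"
  proof (cases "n = 0")
    case True
    then show ?thesis
      using rk N parent pos by (metis DiffD1 insertE less_irrefl)
  next
    case False
    then have "p c \<noteq> r" "p c' \<noteq> r"
      using rk rk_root by auto
    then show ?thesis
      using Suc.hyps(1)[of "p c" "p c'"] rk chain_parent Suc.prems by auto
  qed
  then show ?case
    using chain_sibling Suc.prems by blast
qed

lemma chain_next:
  assumes "c \<in> chain z" "c' \<in> chain z" "rk c < rk c'"
  shows "\<exists>d \<in> chain z. p d = c"
  using assms
proof (induction "rk c'" arbitrary: c' rule: less_induct)
  case less
  have N: "c \<in> N" "c' \<in> N"
    using less.prems by (auto simp: chain_def)
  then have pc: "rk c' = Suc (rk (p c'))" "rk c \<noteq> 0"
    using rk_Suc by auto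
  then have "p c' \<noteq> r"
    using less.prems rk_root by auto
  then have in_chain: "p c' \<in> chain z"
    using chain_parent less.prems by blast
  show ?case
  proof (cases "rk (p c') = rk c")
    case True
    then show ?thesis
      using chain_rk_inj[OF in_chain] less.prems by blast
  next
    case False
    then show ?thesis
      using less.hyps[of "p c'"] in_chain less.prems pc by simp
  qed
qed

lemma leaf_maximal:
  assumes "i \<in> L" "i \<in> chain z" "c \<in> chain z"
  shows "rk c \<le> rk i"
proof (rule ccontr)
  assume "\<not> ?thesis"
  then obtain d where "d \<in> chain z" "p d = i"
    using chain_next assms by (meson not_le)
  then show False
    using parent[of d] assms L_sub r_notin by (auto simp: chain_def)
qed

text \<open>Climbing from any member along parents would end at a member whose parent is the
  root.\<close>

lemma chain_empty:
  assumes "\<And>d. d \<in> chain z \<Longrightarrow> p d \<noteq> r"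
  shows "chain z = {}"
proof -
  have "d \<notin> chain z" for d
  proof (induction "rk d" arbitrary: d rule: less_induct)
    case less
    then show ?case
      using chain_parent[of d z] rk_less[of d] assms[of d] by (auto simp: chain_def)
  qed
  then show ?thesis
    by blast
qed

text \<open>A puncture \<open>a i\<close> has the leaf i in its chain, and nothing follows a leaf.
  As v is last as well, v would be i, against \<open>z \<noteq> a v\<close>.\<close>

lemma chain_max_notin_leaves:
  assumes "v \<in> chain z" "\<And>d. d \<in> chain z \<Longrightarrow> p d \<noteq> v" "z \<noteq> a v"
  shows "z \<notin> a ` L"
proof
  assume "z \<in> a ` L"
  then obtain i where i: "i \<in> L" "z = a i"
    by blast
  then have "i \<in> chain z"
    using L_sub by (auto simp: chain_def)
  then have "rk v \<le> rk i" "rk v \<noteq> rk i"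
    using leaf_maximal chain_rk_inj assms i by blast+
  then show False
    using chain_next[OF assms(1) \<open>i \<in> chain z\<close>] assms(2) by auto
qed

lemma inj_on_leaves: "inj_on a L"
proof (rule inj_onI)
  fix i j assume ij: "i \<in> L" "j \<in> L" "a i = a j"
  then have "i \<in> chain (a i)" "j \<in> chain (a i)"
    using L_sub by (auto simp: chain_def)
  then show "i = j"
    using leaf_maximal ij chain_rk_inj by (meson le_antisym)
qed

text \<open>This cancels all edges off the path. If \<open>w (z - a c)\<close> equals
  \<open>D (p c)\<close>, then z lies in the parent ball and both heights are
  \<open>D (p c)\<close>; if it is smaller, z is equally far from both centres.\<close>

lemma height_outside_chain:
  assumes c: "c \<in> N" "c \<notin> chain z"
  shows "height z c = height z (p c)"
proof -
  have z: "z \<noteq> a c" "w (z - a c) \<le> D (p c)"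
    using c by (auto simp: chain_def)
  have pc: "p c \<notin> L"
    using parent[of c] c r_notin L_sub by auto
  have "height z c = w (z - a c)"
    using z D_less[of c] c by (auto simp: height_def)
  also have "\<dots> = height z (p c)"
  proof (cases "w (z - a c) = D (p c)")
    case True
    then have "z = a (p c) \<or> D (p c) \<le> w (z - a (p c))"
      using w_triangle[of z "a c" "a (p c)"] a_parent[of c] c z by auto
    then show ?thesis
      using pc True by (auto simp: height_def)
  next
    case False
    then have "w (z - a c) < w (a c - a (p c))"
      using z a_parent[of c] c by auto
    then show ?thesis
      using w_isosceles[of z "a c" "a (p c)"] z pc by (auto simp: height_def)
  qed
  finally show ?thesis .
qed

lemma height_parent:
  assumes "c \<in> chain z"
  shows "height z (p c) = D (p c)"
  using chain_imp_ball[OF assms] parent[of c] assms r_notin L_sub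
  by (auto simp: height_def chain_def)

text \<open>A telescoping sum: for a proper ancestor d of c the height difference is the full length
  \<open>D d - D (p d)\<close>, which contributes \<open>q d - q (p d)\<close>. Only the last edge
  keeps its own height.\<close>

lemma sum_chain_upto:
  assumes "c \<in> chain z"
  shows "(\<Sum>d | d \<in> chain z \<and> rk d \<le> rk c. (height z d - height z (p d)) *s s d)
    = q (p c) - q r + (height z c - D (p c)) *s s c"
  using assms
proof (induction "rk c" arbitrary: c rule: less_induct)
  case less
  have c: "c \<in> N"
    using less.prems by (auto simp: chain_def)
  have fin: "finite (chain z)"
    using finite_N by (auto simp: chain_def)
  have set_eq: "{d \<in> chain z. rk d \<le> rk c} = insert c {d \<in> chain z. rk d \<le> rk (p c)}"
    using chain_rk_inj[OF _ less.prems] rk_Suc[OF c] less.prems by (auto simp: le_Suc_eq)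
  have eq: "(\<Sum>d | d \<in> chain z \<and> rk d \<le> rk c. (height z d - height z (p d)) *s s d)
      = (height z c - D (p c)) *s s c
        + (\<Sum>d | d \<in> chain z \<and> rk d \<le> rk (p c). (height z d - height z (p d)) *s s d)"
    unfolding set_eq using fin rk_Suc[OF c] height_parent[OF less.prems] by simp
  show ?case
  proof (cases "p c = r")
    case True
    then have "{d \<in> chain z. rk d \<le> rk (p c)} = {}"
      using rk_root rk_Suc by (auto simp: chain_def)
    then show ?thesis
      using eq True by (simp del: Collect_empty_eq)
  next
    case False
    then have "p c \<in> chain z" "p c \<in> N - L"
      using chain_parent less.prems parent[OF c] by auto
    then have "(\<Sum>d | d \<in> chain z \<and> rk d \<le> rk (p c). (height z d - height z (p d)) *s s d)
        = q (p c) - q r"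
      using less.hyps[of "p c"] rk_Suc[OF c] height_parent[OF less.prems] q_step[of "p c"] by simp
    then show ?thesis
      using eq by simp
  qed
qed

section \<open>The tropicalization as a sum along the chain\<close>

definition trop :: "'k \<Rightarrow> rat ^ 'n" where
  "trop z = q r + (\<Sum>i\<in>L. w (z - a i) *s s i)"

lemma trop_eq_sum_chain:
  "trop z = q r + (\<Sum>c\<in>chain z. (height z c - height z (p c)) *s s c)"
proof -
  have "(\<Sum>i\<in>L. w (z - a i) *s s i) = (\<Sum>i\<in>L. height z i *s s i)"
    by (intro sum.cong) (auto simp: height_def)
  also have "\<dots> = (\<Sum>c\<in>N. (height z c - height z (p c)) *s s c)"
    by (rule sum_leaves)
  also have "\<dots> = (\<Sum>c\<in>chain z. (height z c - height z (p c)) *s s c)"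
    using finite_N height_outside_chain by (intro sum.mono_neutral_right) (auto simp: chain_def)
  finally show ?thesis
    by (simp add: trop_def)
qed

lemma trop_no_chain: "chain z = {} \<Longrightarrow> trop z = q r"
  by (simp add: trop_eq_sum_chain)

lemma trop_chain_max:
  assumes "c \<in> chain z" "\<And>d. d \<in> chain z \<Longrightarrow> p d \<noteq> c"
  shows "trop z = q (p c) + (height z c - D (p c)) *s s c"
proof -
  have "{d \<in> chain z. rk d \<le> rk c} = chain z"
    using chain_next assms by (auto simp: not_le dest: leI)
  then show ?thesis
    using sum_chain_upto[OF assms(1)] by (simp add: trop_eq_sum_chain)
qed

lemma trop_in_image:
  assumes "z \<notin> a ` L"
  shows "trop z \<in> image"
proof (cases "chain z = {}")
  case True
  then show ?thesis
    by (simp add: trop_no_chain image_def)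
next
  case False
  have "finite (chain z)"
    using finite_N by (auto simp: chain_def)
  then have "Max (rk ` chain z) \<in> rk ` chain z"
    using False by (intro Max_in) auto
  then obtain c where c: "c \<in> chain z" "Max (rk ` chain z) = rk c"
    by blast
  then have N: "c \<in> N"
    by (simp add: chain_def)
  have max: "p d \<noteq> c" if "d \<in> chain z" for d
  proof -
    have "rk d \<le> rk c"
      using \<open>finite (chain z)\<close> that unfolding c(2)[symmetric] by simp
    then show ?thesis
      using rk_less[of d] that by (auto simp: chain_def)
  qed
  \<comment> \<open>The last member c of the chain names the edge to which z is sent, at distance
    \<open>height z c - D (p c)\<close> from its start.\<close>
  have "0 < height z c - D (p c)" "c \<in> L \<or> height z c \<le> D c"
    using c N D_less[of c] assms by (auto simp: chain_def height_def)
  moreover have "trop z = q (p c) + (height z c - D (p c)) *s s c"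
    using c(1) max by (rule trop_chain_max)
  ultimately show ?thesis
    unfolding image_def using N by fastforce
qed

text \<open>A generic point of the ball of v works, that is, one in a residue class containing
  neither the centre nor a child. Translation by \<open>a v\<close> and division by t turn the ball
  into the valuation ring, where such a class exists.\<close>

lemma trop_vertex:
  assumes "v \<in> insert r (N - L)"
  shows "\<exists>z. z \<notin> a ` L \<and> trop z = q v"
proof -
  obtain t where t: "t \<noteq> 0" "w t = D v"
    using w_surj by blast
  let ?A = "insert 0 ((\<lambda>c. (a c - a v) / t) ` {c \<in> N. p c = v})"
  have "x = 0 \<or> 0 \<le> w x" if "x \<in> ?A" for x
    using that t a_parent by (auto simp: w_divide)
  then have "\<exists>y. (y = 0 \<or> 0 \<le> w y) \<and> y \<notin> ?A \<and> (\<forall>x\<in>?A. w (y - x) = 0)"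
    using finite_N by (intro new_residue_class) simp_all
  then obtain y where y: "y \<notin> ?A" "\<forall>x\<in>?A. w (y - x) = 0"
    by auto
  define z where "z = a v + t * y"
  have "y \<noteq> 0"
    using y by auto
  then have zv: "z \<noteq> a v" "w (z - a v) = D v"
    using t y(2) by (simp_all add: z_def w_mult)
  have child: "z \<noteq> a c \<and> w (z - a c) = D v" if "c \<in> N" "p c = v" for c
  proof -
    have eq: "z - a c = t * (y - (a c - a v) / t)"
      using t by (simp add: z_def field_simps)
    have "y - (a c - a v) / t \<noteq> 0" "w (y - (a c - a v) / t) = 0"
      using y that by auto
    then show ?thesis
      using t eq by (auto simp: w_mult)
  qed
  then have max: "p d \<noteq> v" if "d \<in> chain z" for d
    using that by (auto simp: chain_def)
  show ?thesis
  proof (cases "v = r")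
    case True
    then have empty: "chain z = {}"
      using chain_empty max by blast
    then have "z \<notin> a ` L"
      using L_sub by (auto simp: chain_def)
    then show ?thesis
      using trop_no_chain empty True by blast
  next
    case False
    then have v: "v \<in> N - L" "v \<in> chain z"
      using assms zv D_less by (auto simp: chain_def)
    then have "trop z = q v"
      using trop_chain_max[OF v(2) max] zv q_step by (simp add: height_def)
    then show ?thesis
      using chain_max_notin_leaves[OF v(2) max] zv by blast
  qed
qed

text \<open>A point whose difference from \<open>a c\<close> has valuation exactly h is in the
  residue class of c. For an interior vertex c it stays outside the ball of c, as
  \<open>h < D c\<close>, so the chain stops at c.\<close>

lemma trop_edge:
  assumes c: "c \<in> N" "D (p c) < h" "c \<in> L \<or> h < D c"
  shows "\<exists>z. z \<notin> a ` L \<and> trop z = q (p c) + (h - D (p c)) *s s c"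
proof -
  obtain t where t: "t \<noteq> 0" "w t = h"
    using w_surj by blast
  define z where "z = a c + t"
  have zc: "z \<noteq> a c" "w (z - a c) = h"
    using t by (simp_all add: z_def)
  have in_chain: "c \<in> chain z"
    using c zc by (auto simp: chain_def)
  have max: "p d \<noteq> c" if "d \<in> chain z" for d
    using chain_imp_ball[OF that] parent[of d] that c zc r_notin by (auto simp: chain_def)
  have "trop z = q (p c) + (h - D (p c)) *s s c"
    using trop_chain_max[OF in_chain max] zc c by (auto simp: height_def)
  then show ?thesis
    using chain_max_notin_leaves[OF in_chain max] zc by blast
qed

lemma trop_image: "insert (q r) (trop ` (- a ` L)) = image"
proof
  show "insert (q r) (trop ` (- a ` L)) \<subseteq> image"
    using trop_in_image by (auto simp: image_def)
next
  have "q (p c) + t *s s c \<in> trop ` (- a ` L)"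
    if c: "c \<in> N" "0 < t" "c \<in> L \<or> t \<le> D c - D (p c)" for c t
  proof (cases "c \<notin> L \<and> t = D c - D (p c)")
    case True
    then have "q (p c) + t *s s c = q c"
      using q_step c by simp
    moreover obtain z where "z \<notin> a ` L" "trop z = q c"
      using trop_vertex[of c] True c by auto
    ultimately show ?thesis
      by force
  next
    case False
    then obtain z where "z \<notin> a ` L" "trop z = q (p c) + (D (p c) + t - D (p c)) *s s c"
      using trop_edge[of c "D (p c) + t"] c by force
    then show ?thesis
      by force
  qed
  then show "image \<subseteq> insert (q r) (trop ` (- a ` L))"
    by (auto simp: image_def)
qed

end

lemma tree_realisation:
  fixes w :: "'k::alg_closed_field \<Rightarrow> rat"
  assumes "weighted_tree N r p rk L D s q" "alg_closed_valued_field w"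
  obtains a where "inj_on a L"
    "insert (q r) ((\<lambda>z. q r + (\<Sum>i\<in>L. w (z - a i) *s s i)) ` (- a ` L))
       = weighted_tree.image N r p L D s q"
proof -
  interpret weighted_tree N r p rk L D s q by fact
  interpret alg_closed_valued_field w by fact
  obtain y where y: "\<And>c. c \<in> N \<Longrightarrow> y c \<noteq> 0 \<and> w (y c) = 0 \<and>
      (\<forall>c'\<in>N. c \<noteq> c' \<longrightarrow> y c \<noteq> y c' \<and> w (y c - y c') = 0)"
    using distinct_residue_classes[OF finite_N] by blast
  \<comment> \<open>The scaling factor depends on the radius alone, so siblings share it, and the
    difference of their centres is this factor times the unit \<open>y c - y c'\<close>.\<close>
  obtain t where t: "\<And>h. t h \<noteq> 0" "\<And>h. w (t h) = h"
    using w_surj by metis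
  obtain a where a: "\<And>c. c \<in> N \<Longrightarrow> a c = a (p c) + t (D (p c)) * y c"
    using tree_recursion[of 0 "\<lambda>c x. x + t (D (p c)) * y c"] by blast
  interpret ball_tree N r p rk L D s q w a
  proof
    fix c assume c: "c \<in> N"
    then have "a c - a (p c) = t (D (p c)) * y c"
      using a by simp
    then show "a c \<noteq> a (p c) \<and> w (a c - a (p c)) = D (p c)"
      using t y[OF c] by (auto simp: w_mult)
    fix c' assume c': "c' \<in> N" "p c = p c'" "c \<noteq> c'"
    then have "a c - a c' = t (D (p c)) * (y c - y c')"
      using a[OF c] a[OF c'(1)] by (simp add: algebra_simps)
    moreover have "y c - y c' \<noteq> 0" "w (y c - y c') = 0"
      using y[OF c] c' by auto
    ultimately show "a c \<noteq> a c' \<and> w (a c - a c') = D (p c)"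
      using t by (auto simp: w_mult)
  qed
  show ?thesis
    using that[OF inj_on_leaves] trop_image by (simp add: trop_def)
qed


section \<open>Connected graphs without cycles\<close>

text \<open>\<open>dim\<close> is 0 also when a basis is infinite, so the basis has to be bounded:
  the cycle space lies in the span of the finitely many single edges.\<close>

lemma cycle_space_trivial:
  fixes G :: "('a, 'b) pre_digraph"
  assumes "finite (arcs G)" "first_betti_number G = 0" "c \<in> cycle_space G"
  shows "c = 0"
proof -
  interpret V: vector_space "\<lambda>(x :: rat). Poly_Mapping.map ((*) x) :: ('b \<Rightarrow>\<^sub>0 rat) \<Rightarrow> _"
    by (rule vector_space_chains)
  let ?S = "(\<lambda>e. Poly_Mapping.single e (1 :: rat)) ` arcs G"
  have span: "x \<in> V.span ?S" if "x \<in> cycle_space G" for x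
  proof -
    have keys: "Poly_Mapping.keys x \<subseteq> arcs G"
      using that by (simp add: cycle_space_def)
    have "x = (\<Sum>e\<in>Poly_Mapping.keys x. Poly_Mapping.single e (Poly_Mapping.lookup x e))"
      by (rule poly_mapping_eqI) (simp add: lookup_sum lookup_single when_def in_keys_iff)
    also have "\<dots> = (\<Sum>e\<in>Poly_Mapping.keys x.
        Poly_Mapping.map ((*) (Poly_Mapping.lookup x e)) (Poly_Mapping.single e 1))"
      by (simp add: map_single)
    also have "\<dots> \<in> V.span ?S"
      using keys by (intro V.span_sum V.span_scale V.span_base) auto
    finally show ?thesis .
  qed
  obtain B where B: "B \<subseteq> cycle_space G" "V.independent B" "cycle_space G \<subseteq> V.span B"
      "card B = V.dim (cycle_space G)"
    using V.basis_exists[of "cycle_space G"] by blast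
  have "finite B"
  proof (rule conjunct1[OF V.independent_span_bound[of ?S]])
    show "B \<subseteq> V.span ?S"
      using B(1) span by blast
  qed (use assms(1) B(2) in simp_all)
  then have "B = {}"
    using B(4) assms(2) by (simp add: first_betti_number_def)
  then show ?thesis
    using B(3) assms(3) by auto
qed

locale rooted_acyclic_graph = fin_digraph G
  for G :: "('a, 'b) pre_digraph" +
  fixes r :: 'a
  assumes connected: "Digraph_Component.connected G"
    and betti: "first_betti_number G = 0"
    and root: "r \<in> verts G"
begin

section \<open>A spanning tree of shortest paths\<close>

definition joins :: "'b \<Rightarrow> 'a \<Rightarrow> 'a \<Rightarrow> bool" where
  "joins e u v \<longleftrightarrow> e \<in> arcs G \<and> (tail G e = u \<and> head G e = v \<or> tail G e = v \<and> head G e = u)"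

definition adj :: "('a \<times> 'a) set" where
  "adj = {(u, v). \<exists>e. joins e u v}"

definition rk :: "'a \<Rightarrow> nat" where
  "rk v = (LEAST n. (r, v) \<in> adj ^^ n)"

lemma joins_verts: "joins e u v \<Longrightarrow> u \<in> verts G \<and> v \<in> verts G"
  by (auto simp: joins_def)

lemma rk_root: "rk r = 0"
  unfolding rk_def by (rule Least_eq_0) simp

lemma reach: "v \<in> verts G \<Longrightarrow> (r, v) \<in> adj ^^ rk v"
proof -
  assume "v \<in> verts G"
  then have "(r, v) \<in> rtrancl_on (verts G) ((arcs_ends G)\<^sup>s)"
    using connected root by (simp add: connected_conv)
  then have "(r, v) \<in> adj\<^sup>*"
  proof (induction rule: rtrancl_on_induct)
    case (step y z)
    then have "(y, z) \<in> adj"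
      by (auto simp: symcl_def arcs_ends_def arc_to_ends_def adj_def joins_def)
    then show ?case
      using step.IH by simp
  qed simp
  then have "\<exists>n. (r, v) \<in> adj ^^ n"
    by (simp add: rtrancl_power)
  then show ?thesis
    unfolding rk_def by (rule LeastI_ex)
qed

text \<open>The vertex before v on a shortest path from \<open>r\<close> qualifies.\<close>

lemma ex_parent:
  assumes "v \<in> verts G - {r}"
  shows "\<exists>u e. joins e u v \<and> rk v = Suc (rk u)"
proof (cases "rk v")
  case 0
  then show ?thesis
    using reach[of v] assms by simp
next
  case (Suc n)
  then obtain u where u: "(r, u) \<in> adj ^^ n" "(u, v) \<in> adj"
    using reach[of v] assms by auto
  then obtain e where e: "joins e u v"
    by (auto simp: adj_def)
  have "rk u \<le> n"
    unfolding rk_def using u(1) by (rule Least_le)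
  moreover have "(r, v) \<in> adj ^^ Suc (rk u)"
    using reach[of u] joins_verts[OF e] u(2) by auto
  then have "rk v \<le> Suc (rk u)"
    unfolding rk_def[of v] by (rule Least_le)
  ultimately show ?thesis
    using Suc e by auto
qed

definition parent :: "'a \<Rightarrow> 'a" where
  "parent v = (SOME u. \<exists>e. joins e u v \<and> rk v = Suc (rk u))"

definition edge :: "'a \<Rightarrow> 'b" where
  "edge v = (SOME e. joins e (parent v) v)"

lemma
  assumes "v \<in> verts G - {r}"
  shows joins_edge: "joins (edge v) (parent v) v"
    and rk_parent: "rk v = Suc (rk (parent v))"
proof -
  have *: "\<exists>e. joins e (parent v) v \<and> rk v = Suc (rk (parent v))"
    unfolding parent_def by (rule someI_ex) (rule ex_parent[OF assms])
  then show "rk v = Suc (rk (parent v))"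
    by blast
  show "joins (edge v) (parent v) v"
    unfolding edge_def by (rule someI_ex) (use * in blast)
qed

text \<open>If both ends of an edge used it to reach their parents, each would have a larger rank
  than the other.\<close>

lemma inj_on_edge: "inj_on edge (verts G - {r})"
proof (rule inj_onI)
  fix u v assume uv: "u \<in> verts G - {r}" "v \<in> verts G - {r}" "edge u = edge v"
  have "u = v \<or> parent u = v \<and> parent v = u"
    using joins_edge[OF uv(1)] joins_edge[OF uv(2)] uv(3) unfolding joins_def by auto
  then show "u = v"
    using rk_parent[OF uv(1)] rk_parent[OF uv(2)] by auto
qed

text \<open>The coefficient at u of the cellular boundary of the chain c.\<close>

definition flow :: "('b \<Rightarrow>\<^sub>0 rat) \<Rightarrow> 'a \<Rightarrow> rat" where
  "flow c u = (\<Sum>e\<in>in_arcs G u. Poly_Mapping.lookup c e) - (\<Sum>e\<in>out_arcs G u. Poly_Mapping.lookup c e)"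

lemma flow_add: "flow (c + d) u = flow c u + flow d u"
  by (simp add: flow_def lookup_add sum.distrib)

lemma flow_minus: "flow (c - d) u = flow c u - flow d u"
  by (simp add: flow_def lookup_minus sum_subtractf)

lemma flow_single:
  assumes "e \<in> arcs G"
  shows "flow (Poly_Mapping.single e x) u = (if head G e = u then x else 0) - (if tail G e = u then x else 0)"
  using assms by (simp add: flow_def lookup_single when_def finite_in_arcs finite_out_arcs)

text \<open>The chain is the tree path from \<open>r\<close> to v, every edge signed so as to point
  away from \<open>r\<close>.\<close>

lemma ex_path:
  assumes "v \<in> verts G"
  shows "\<exists>c. Poly_Mapping.keys c \<subseteq> edge ` (verts G - {r}) \<and>
    (\<forall>u. flow c u = (if u = v then 1 else 0) - (if u = r then 1 else 0))"
  using assms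
proof (induction "rk v" arbitrary: v rule: less_induct)
  case less
  show ?case
  proof (cases "v = r")
    case True
    then show ?thesis
      by (intro exI[of _ 0]) (simp add: flow_def)
  next
    case False
    then have v: "v \<in> verts G - {r}"
      using less.prems by simp
    note j = joins_edge[OF v]
    obtain c where c: "Poly_Mapping.keys c \<subseteq> edge ` (verts G - {r})"
      "\<And>u. flow c u = (if u = parent v then 1 else 0) - (if u = r then 1 else 0)"
      using less.hyps[of "parent v"] joins_verts[OF j] rk_parent[OF v] by auto
    define x :: rat where "x = (if head G (edge v) = v then 1 else - 1)"
    have "parent v \<noteq> v"
      using rk_parent[OF v] by auto
    then have "flow (c + Poly_Mapping.single (edge v) x) u
        = (if u = v then 1 else 0) - (if u = r then 1 else 0)" for u
      using j c(2) by (auto simp: flow_add flow_single x_def joins_def)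
    moreover have "Poly_Mapping.keys (c + Poly_Mapping.single (edge v) x) \<subseteq> edge ` (verts G - {r})"
      using c(1) v by (intro order.trans[OF Poly_Mapping.keys_add]) (simp add: keys_single)
    ultimately show ?thesis
      by blast
  qed
qed

text \<open>An edge outside the spanning tree, closed up by the tree paths to its two ends, is a
  fundamental cycle. Its coefficient at that edge is 1, which the vanishing Betti number
  forbids.\<close>

lemma edge_image: "edge ` (verts G - {r}) = arcs G"
proof
  show sub: "edge ` (verts G - {r}) \<subseteq> arcs G"
    using joins_edge by (auto simp: joins_def)
  show "arcs G \<subseteq> edge ` (verts G - {r})"
  proof (rule ccontr)
    assume "\<not> ?thesis"
    then obtain e where e: "e \<in> arcs G" "e \<notin> edge ` (verts G - {r})"
      by blast
    obtain c where c: "Poly_Mapping.keys c \<subseteq> edge ` (verts G - {r})"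
      "\<And>u. flow c u = (if u = tail G e then 1 else 0) - (if u = r then 1 else 0)"
      using ex_path[of "tail G e"] e by auto
    obtain d where d: "Poly_Mapping.keys d \<subseteq> edge ` (verts G - {r})"
      "\<And>u. flow d u = (if u = head G e then 1 else 0) - (if u = r then 1 else 0)"
      using ex_path[of "head G e"] e by auto
    let ?z = "Poly_Mapping.single e 1 + c - d"
    have "flow ?z u = 0" for u
      using c(2) d(2) e by (simp add: flow_add flow_minus flow_single)
    moreover have keys: "Poly_Mapping.keys ?z \<subseteq> arcs G"
    proof
      fix e' assume "e' \<in> Poly_Mapping.keys ?z"
      then have "e' = e \<or> e' \<in> Poly_Mapping.keys c \<or> e' \<in> Poly_Mapping.keys d"
        by (auto simp: in_keys_iff lookup_add lookup_minus lookup_single when_def split: if_splits)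
      then show "e' \<in> arcs G"
        using c(1) d(1) e(1) sub by blast
    qed
    ultimately have "?z \<in> cycle_space G"
      by (simp add: cycle_space_def flow_def)
    then have "?z = 0"
      using cycle_space_trivial[OF finite_arcs betti] by blast
    then have "Poly_Mapping.lookup ?z e = 0"
      by simp
    moreover have "Poly_Mapping.lookup c e = 0" "Poly_Mapping.lookup d e = 0"
      using c(1) d(1) e by (auto simp: in_keys_iff)
    ultimately show False
      by (simp add: lookup_add lookup_minus)
  qed
qed

lemma arcE:
  assumes "e \<in> arcs G"
  obtains c where "c \<in> verts G - {r}" "e = edge c"
  using assms edge_image by blast

lemma no_loop:
  assumes "e \<in> arcs G"
  shows "tail G e \<noteq> head G e"
proof -
  obtain c where c: "c \<in> verts G - {r}" "e = edge c"
    using assms by (rule arcE)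
  then show ?thesis
    using joins_edge[OF c(1)] rk_parent[OF c(1)] by (auto simp: joins_def)
qed

lemma edges_at_eq:
  assumes "v \<in> verts G"
  shows "edges_at G v = (if v = r then {} else {edge v}) \<union> edge ` {c \<in> verts G - {r}. parent c = v}"
proof -
  have "e \<in> edges_at G v \<longleftrightarrow> (\<exists>c\<in>verts G - {r}. e = edge c \<and> (c = v \<or> parent c = v))" for e
  proof
    assume "e \<in> edges_at G v"
    then have "e \<in> arcs G" "tail G e = v \<or> head G e = v"
      by (auto simp: edges_at_def)
    moreover from this obtain c where "c \<in> verts G - {r}" "e = edge c"
      using arcE by blast
    moreover from this have "joins (edge c) (parent c) c"
      using joins_edge by blast
    ultimately show "\<exists>c\<in>verts G - {r}. e = edge c \<and> (c = v \<or> parent c = v)"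
      by (intro bexI[of _ c]) (auto simp: joins_def)
  next
    assume "\<exists>c\<in>verts G - {r}. e = edge c \<and> (c = v \<or> parent c = v)"
    then obtain c where "c \<in> verts G - {r}" "e = edge c" "c = v \<or> parent c = v"
      by blast
    moreover from this have "joins (edge c) (parent c) c"
      using joins_edge by blast
    ultimately show "e \<in> edges_at G v"
      unfolding edges_at_def joins_def by auto
  qed
  then show ?thesis
    using assms by (auto split: if_splits)
qed

text \<open>The sum of the degrees counts a loop twice, so the absence of loops enters here.\<close>

lemma degree_eq_card_edges_at: "in_degree G v + out_degree G v = card (edges_at G v)"
proof -
  have "in_arcs G v \<inter> out_arcs G v = {}"
  proof -
    have False if "e \<in> in_arcs G v" "e \<in> out_arcs G v" for e
      using no_loop[of e] that by simp
    then show ?thesis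
      by blast
  qed
  then show ?thesis
    unfolding edges_at_def in_degree_def out_degree_def
    by (simp add: card_Un_disjoint finite_in_arcs finite_out_arcs)
qed

end


section \<open>The projective line\<close>

definition of_poly :: "'k::field poly \<Rightarrow> 'k universal" where
  "of_poly p = to_ac (Fraction_Field.Fract p 1)"

lemma of_poly_0 [simp]: "of_poly 0 = 0"
  by (simp add: of_poly_def flip: Zero_fract_def)

lemma of_poly_1 [simp]: "of_poly 1 = 1"
  by (simp add: of_poly_def flip: One_fract_def)

lemma of_poly_add: "of_poly (p + q) = of_poly p + of_poly q"
  by (simp add: of_poly_def flip: to_ac_add)

lemma of_poly_diff: "of_poly (p - q) = of_poly p - of_poly q"
  by (simp add: of_poly_def flip: to_ac_diff)

lemma of_poly_mult: "of_poly (p * q) = of_poly p * of_poly q"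
  by (simp add: of_poly_def flip: to_ac_mult)

lemma of_poly_sum: "of_poly (\<Sum>i\<in>A. f i) = (\<Sum>i\<in>A. of_poly (f i))"
  by (induction A rule: infinite_finite_induct) (simp_all add: of_poly_add)

lemma of_poly_eq_iff [simp]: "of_poly p = of_poly q \<longleftrightarrow> p = q"
  by (simp add: of_poly_def eq_fract)

lemma of_poly_eq_0_iff [simp]: "of_poly p = 0 \<longleftrightarrow> p = 0"
  using of_poly_eq_iff[of p 0] by (simp del: of_poly_eq_iff)

lemma const_eq_of_poly: "const c = of_poly [:c:]"
  by (simp add: const_def of_poly_def)

lemma const_0 [simp]: "const 0 = 0"
  by (simp add: const_eq_of_poly)

lemma const_1 [simp]: "const 1 = 1"
  by (simp add: const_eq_of_poly flip: one_pCons)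

lemma const_diff: "const (a - b) = const a - const b"
  by (simp add: const_eq_of_poly flip: of_poly_diff)

lemma const_minus: "const (- a) = - const a"
  using const_diff[of 0 a] by simp

lemma const_mult: "const (a * b) = const a * const b"
  by (simp add: const_eq_of_poly mult.commute flip: of_poly_mult)

lemma const_eq_iff [simp]: "const a = const b \<longleftrightarrow> a = b"
  by (simp add: const_eq_of_poly)

lemma const_eq_0_iff [simp]: "const a = 0 \<longleftrightarrow> a = 0"
  using const_eq_iff[of a 0] by (simp del: const_eq_iff)

lemma const_inverse: "const (inverse a) = inverse (const a)"
proof (cases "a = 0")
  case False
  then have "const (inverse a) * const a = 1"
    by (simp flip: const_mult)
  then show ?thesis
    by (metis inverse_unique mult.commute)
qed simp

definition gen :: "'k::field universal" where
  "gen = of_poly [:0, 1:]"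

lemma of_poly_linear: "of_poly [:- a, 1:] = gen - const a"
  by (simp add: gen_def const_eq_of_poly flip: of_poly_diff)

lemma eval_const_gen: "eval_const p gen = of_poly p"
proof (induction p)
  case (pCons a p)
  have "eval_const (pCons a p) gen = const a + gen * eval_const p gen"
    by (simp add: eval_const_def map_poly_pCons)
  also have "\<dots> = of_poly ([:a:] + [:0, 1:] * p)"
    by (subst pCons.IH) (simp only: of_poly_add of_poly_mult const_eq_of_poly gen_def)
  finally show ?case
    by simp
qed (simp add: eval_const_def)

abbreviation ratfuns :: "'k::field universal set" where
  "ratfuns \<equiv> simple_extension gen"

lemma ratfuns_eq: "ratfuns = {of_poly p / of_poly q | p q. q \<noteq> 0}"
  by (simp add: simple_extension_def eval_const_gen)

lemma ratfunsE:
  assumes "f \<in> ratfuns"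
  obtains p q where "q \<noteq> 0" "f = of_poly p / of_poly q"
  using assms by (auto simp: ratfuns_eq)

lemma ratfuns_divide_of_poly: "q \<noteq> 0 \<Longrightarrow> of_poly p / of_poly q \<in> ratfuns"
  by (auto simp: ratfuns_eq)

lemma ratfuns_of_poly [simp]: "of_poly p \<in> ratfuns"
  using ratfuns_divide_of_poly[of 1 p] by simp

lemma ratfuns_0 [simp]: "0 \<in> ratfuns"
  using ratfuns_of_poly[of 0] by simp

lemma ratfuns_const [simp]: "const c \<in> ratfuns"
  by (simp add: const_eq_of_poly)

lemma gen_in_ratfuns [simp]: "gen \<in> ratfuns"
  using ratfuns_of_poly[of "[:0, 1:]"] by (simp flip: gen_def)

lemma ratfuns_add: "f \<in> ratfuns \<Longrightarrow> g \<in> ratfuns \<Longrightarrow> f + g \<in> ratfuns"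
proof (elim ratfunsE)
  fix p q p' q' assume "q \<noteq> 0" "f = of_poly p / of_poly q" "q' \<noteq> 0" "g = of_poly p' / of_poly q'"
  then have "f + g = of_poly (p * q' + p' * q) / of_poly (q * q')"
    by (simp add: of_poly_add of_poly_mult field_simps)
  then show "f + g \<in> ratfuns"
    using \<open>q \<noteq> 0\<close> \<open>q' \<noteq> 0\<close> ratfuns_divide_of_poly[of "q * q'"] by simp
qed

lemma ratfuns_mult: "f \<in> ratfuns \<Longrightarrow> g \<in> ratfuns \<Longrightarrow> f * g \<in> ratfuns"
proof (elim ratfunsE)
  fix p q p' q' assume "q \<noteq> 0" "f = of_poly p / of_poly q" "q' \<noteq> 0" "g = of_poly p' / of_poly q'"
  then show "f * g \<in> ratfuns"
    using ratfuns_divide_of_poly[of "q * q'" "p * p'"] by (simp add: of_poly_mult)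
qed

lemma ratfuns_minus: "f \<in> ratfuns \<Longrightarrow> - f \<in> ratfuns"
  using ratfuns_mult[OF ratfuns_const[of "- 1"]] by (simp add: const_minus)

lemma ratfuns_diff: "f \<in> ratfuns \<Longrightarrow> g \<in> ratfuns \<Longrightarrow> f - g \<in> ratfuns"
  using ratfuns_add[of f "- g"] ratfuns_minus[of g] by simp

lemma ratfuns_inverse: "f \<in> ratfuns \<Longrightarrow> inverse f \<in> ratfuns"
proof (elim ratfunsE)
  fix p q assume "q \<noteq> 0" "f = of_poly p / of_poly q"
  then show "inverse f \<in> ratfuns"
    using ratfuns_divide_of_poly[of p q] ratfuns_of_poly[of 0] by (cases "p = 0") auto
qed

lemma ratfuns_divide: "f \<in> ratfuns \<Longrightarrow> g \<in> ratfuns \<Longrightarrow> f / g \<in> ratfuns"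
  using ratfuns_mult[of f "inverse g"] ratfuns_inverse[of g] by (simp add: divide_inverse)

lemma ratfuns_power_int: "f \<in> ratfuns \<Longrightarrow> f powi k \<in> ratfuns"
proof -
  assume f: "f \<in> ratfuns"
  have power: "f ^ n \<in> ratfuns" for n
    by (induction n) (use f ratfuns_mult ratfuns_const[of 1] in auto)
  show ?thesis
    using power ratfuns_inverse[OF power] by (simp add: power_int_def power_inverse)
qed

lemma ratfuns_prod: "(\<And>i. i \<in> A \<Longrightarrow> f i \<in> ratfuns) \<Longrightarrow> (\<Prod>i\<in>A. f i) \<in> ratfuns"
  by (induction A rule: infinite_finite_induct) (use ratfuns_mult ratfuns_const[of 1] in auto)

lemma function_field_ratfuns: "function_field (ratfuns :: 'k::field universal set)"
  unfolding function_field_def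
proof (intro conjI ballI)
  show "\<exists>x\<in>ratfuns. (\<forall>p. p \<noteq> 0 \<longrightarrow> eval_const p x \<noteq> 0) \<and>
    (\<exists>B. finite B \<and> B \<subseteq> ratfuns \<and>
      (\<forall>f\<in>ratfuns. \<exists>a. (\<forall>b\<in>B. a b \<in> simple_extension x) \<and> f = (\<Sum>b\<in>B. a b * b :: 'k universal)))"
  proof (intro bexI[of _ gen] conjI exI[of _ "{1}"] ballI)
    fix f :: "'k universal" assume "f \<in> ratfuns"
    then show "\<exists>a. (\<forall>b\<in>{1}. a b \<in> ratfuns) \<and> f = (\<Sum>b\<in>{1}. a b * b)"
      by (intro exI[of _ "\<lambda>_. f"]) simp
  qed (use ratfuns_const[of 1] in \<open>simp_all add: eval_const_gen gen_in_ratfuns\<close>)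
qed (auto intro: ratfuns_add ratfuns_mult ratfuns_minus ratfuns_inverse)


subsection \<open>Points\<close>

text \<open>Extends an order function from polynomials to quotients. The fraction picked by
  \<open>SOME\<close> is immaterial once d is multiplicative.\<close>

definition place :: "('k::field poly \<Rightarrow> int) \<Rightarrow> 'k point" where
  "place d f = (if f \<in> ratfuns - {0}
     then (let (p, q) = (SOME (p, q). q \<noteq> 0 \<and> f = of_poly p / of_poly q) in d p - d q) else 0)"

definition multiplicative_order :: "('k::field poly \<Rightarrow> int) \<Rightarrow> bool" where
  "multiplicative_order d \<longleftrightarrow> (\<forall>p q. p \<noteq> 0 \<longrightarrow> q \<noteq> 0 \<longrightarrow> d (p * q) = d p + d q)"

lemma place_divide:
  assumes "multiplicative_order d" "p \<noteq> 0" "q \<noteq> 0"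
  shows "place d (of_poly p / of_poly q) = d p - d q"
proof -
  let ?R = "\<lambda>(p', q'). q' \<noteq> 0 \<and> of_poly p / of_poly q = of_poly p' / of_poly q'"
  obtain p' q' where eq: "(SOME x. ?R x) = (p', q')"
    by force
  have "?R (SOME x. ?R x)"
    by (rule someI[of ?R "(p, q)"]) (use assms in auto)
  then have pq': "q' \<noteq> 0" "of_poly p / of_poly q = of_poly p' / of_poly q'"
    by (auto simp: eq)
  then have "of_poly (p * q') = of_poly (p' * q)"
    using assms by (simp add: of_poly_mult frac_eq_eq)
  then have "p * q' = p' * q"
    by simp
  moreover from this have "p' \<noteq> 0"
    using assms pq' by auto
  ultimately have "d p + d q' = d p' + d q"
    using assms pq' unfolding multiplicative_order_def by metis
  moreover have "of_poly p / of_poly q \<in> ratfuns - {0}"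
    using assms ratfuns_divide_of_poly by auto
  ultimately show ?thesis
    unfolding place_def using eq by simp
qed

lemma place_of_poly:
  assumes "multiplicative_order d" "p \<noteq> 0"
  shows "place d (of_poly p) = d p"
proof -
  have "d 1 = 0"
    using assms(1)[unfolded multiplicative_order_def, rule_format, of 1 1] by simp
  then show ?thesis
    using place_divide[OF assms, of 1] by simp
qed

text \<open>One criterion serves both kinds of points, with d the order at a or minus the degree.
  Normalisation is witnessed by a quotient, since minus the degree is never positive on
  polynomials.\<close>

lemma place_in_completion:
  assumes mult: "multiplicative_order d"
    and add: "\<And>p q. p \<noteq> 0 \<Longrightarrow> q \<noteq> 0 \<Longrightarrow> p + q \<noteq> 0 \<Longrightarrow> min (d p) (d q) \<le> d (p + q)"
    and const: "\<And>c. c \<noteq> 0 \<Longrightarrow> d [:c:] = 0"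
    and norm: "p0 \<noteq> 0" "q0 \<noteq> 0" "d p0 - d q0 = 1"
  shows "place d \<in> smooth_completion ratfuns"
proof -
  have d_mult: "d (p * q) = d p + d q" if "p \<noteq> 0" "q \<noteq> 0" for p q
    using mult that by (simp add: multiplicative_order_def)
  have "place d (f * g) = place d f + place d g"
    if fg: "f \<in> ratfuns" "g \<in> ratfuns" "f \<noteq> 0" "g \<noteq> 0" for f g
  proof -
    obtain p q p' q' where pq: "q \<noteq> 0" "f = of_poly p / of_poly q" "q' \<noteq> 0" "g = of_poly p' / of_poly q'"
      using fg by (meson ratfunsE)
    then have "f * g = of_poly (p * p') / of_poly (q * q')" "p \<noteq> 0" "p' \<noteq> 0"
      using fg by (auto simp: of_poly_mult)
    then show ?thesis
      using pq by (simp add: place_divide[OF mult] d_mult)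
  qed
  moreover have "min (place d f) (place d g) \<le> place d (f + g)"
    if fg: "f \<in> ratfuns" "g \<in> ratfuns" "f \<noteq> 0" "g \<noteq> 0" "f + g \<noteq> 0" for f g
  proof -
    obtain p q p' q' where pq: "q \<noteq> 0" "f = of_poly p / of_poly q" "q' \<noteq> 0" "g = of_poly p' / of_poly q'"
      using fg by (meson ratfunsE)
    then have sum: "f + g = of_poly (p * q' + p' * q) / of_poly (q * q')"
      by (simp add: of_poly_add of_poly_mult field_simps)
    have nz: "p \<noteq> 0" "p' \<noteq> 0" "p * q' + p' * q \<noteq> 0"
      using fg pq sum by auto
    have "min (d (p * q')) (d (p' * q)) \<le> d (p * q' + p' * q)"
      using nz pq by (intro add) auto
    then show ?thesis
      unfolding sum using pq nz by (simp add: place_divide[OF mult] d_mult)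
  qed
  moreover have "place d (const c) = 0" if "c \<noteq> 0" for c
    using place_of_poly[OF mult, of "[:c:]"] that const by (simp add: const_eq_of_poly)
  moreover have "\<exists>f\<in>ratfuns. f \<noteq> 0 \<and> place d f = 1"
    using norm place_divide[OF mult, of p0 q0]
    by (intro bexI[of _ "of_poly p0 / of_poly q0"]) (auto intro: ratfuns_divide_of_poly)
  moreover have "place d f = 0" if "f = 0 \<or> f \<notin> ratfuns" for f
    using that by (auto simp: place_def)
  ultimately show ?thesis
    unfolding smooth_completion_def by blast
qed

definition place_at :: "'k::field \<Rightarrow> 'k point" where
  "place_at a = place (\<lambda>p. int (Polynomial.order a p))"

definition place_inf :: "'k::field point" where
  "place_inf = place (\<lambda>p. - int (Polynomial.degree p))"

lemma multiplicative_order_order: "multiplicative_order (\<lambda>p. int (Polynomial.order a p))"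
  by (simp add: multiplicative_order_def order_mult)

lemma multiplicative_order_degree:
  "multiplicative_order (\<lambda>p :: 'k::field poly. - int (Polynomial.degree p))"
  by (simp add: multiplicative_order_def degree_mult_eq)

lemmas place_at_divide = place_divide[OF multiplicative_order_order, folded place_at_def]
lemmas place_at_of_poly = place_of_poly[OF multiplicative_order_order, folded place_at_def]
lemmas place_inf_of_poly = place_of_poly[OF multiplicative_order_degree, folded place_inf_def]

lemma order_linear: "Polynomial.order a [:- b, 1:] = (if a = b then 1 else 0)"
proof (cases "a = b")
  case True
  then show ?thesis
    using order_power_n_n[of b 1] by simp
qed (simp add: order_0I)

lemma place_at_linear: "place_at a (gen - const b) = (if a = b then 1 else 0)"
  using place_at_of_poly[of "[:- b, 1:]" a] by (simp add: of_poly_linear order_linear)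

lemma place_inf_linear: "place_inf (gen - const b) = - 1"
  using place_inf_of_poly[of "[:- b, 1:]"] by (simp add: of_poly_linear)

lemma place_at_in_completion: "place_at a \<in> smooth_completion ratfuns"
  unfolding place_at_def
proof (rule place_in_completion[OF multiplicative_order_order, of _ "[:- a, 1:]" 1])
  fix p q :: "'a poly" assume *: "p \<noteq> 0" "q \<noteq> 0" "p + q \<noteq> 0"
  let ?n = "min (Polynomial.order a p) (Polynomial.order a q)"
  have "[:- a, 1:] ^ ?n dvd p + q"
    by (intro dvd_add) (simp_all add: order_divides)
  then show "min (int (Polynomial.order a p)) (int (Polynomial.order a q))
      \<le> int (Polynomial.order a (p + q))"
    using * by (simp add: order_divides flip: of_nat_min)
qed (simp_all add: order_linear order_0I)

lemma place_inf_in_completion: "place_inf \<in> smooth_completion ratfuns"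
  unfolding place_inf_def
proof (rule place_in_completion[OF multiplicative_order_degree, of 1 "[:0, 1:]"])
  fix p q :: "'a poly"
  show "min (- int (Polynomial.degree p)) (- int (Polynomial.degree q)) \<le> - int (Polynomial.degree (p + q))"
    using degree_add_le_max[of p q] by linarith
qed simp_all

lemma place_at_eq_iff [simp]: "place_at a = place_at b \<longleftrightarrow> a = b"
  using place_at_linear[of a a] place_at_linear[of b a] by (auto split: if_splits)

lemma place_at_neq_inf [simp]: "place_at a \<noteq> place_inf" "place_inf \<noteq> place_at a"
  using place_at_linear[of a a] place_inf_linear[of a] by auto

lemma place_at_outside: "f = 0 \<or> f \<notin> ratfuns \<Longrightarrow> place_at a f = 0"
  by (auto simp: place_at_def place_def)

lemma finite_zeros_and_poles: "finite {a. place_at a f \<noteq> 0}"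
proof (cases "f \<in> ratfuns \<and> f \<noteq> 0")
  case True
  then obtain p q where pq: "q \<noteq> 0" "f = of_poly p / of_poly q" "p \<noteq> 0"
    by (metis ratfunsE div_0 of_poly_0)
  have "{a. place_at a f \<noteq> 0} \<subseteq> {a. Polynomial.poly p a = 0} \<union> {a. Polynomial.poly q a = 0}"
    using pq by (auto simp: place_at_divide order_root)
  then show ?thesis
    using pq poly_roots_finite finite_subset by blast
next
  case False
  then have "{a. place_at a f \<noteq> 0} = {}"
    using place_at_outside by blast
  then show ?thesis
    by (simp only: finite.emptyI)
qed

section \<open>Classification of the points of the projective line\<close>

locale point =
  fixes P :: "'k::field point"
  assumes point: "P \<in> smooth_completion ratfuns"
begin

lemma mult: "f \<in> ratfuns \<Longrightarrow> g \<in> ratfuns \<Longrightarrow> f \<noteq> 0 \<Longrightarrow> g \<noteq> 0 \<Longrightarrow> P (f * g) = P f + P g"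
  using point by (simp add: smooth_completion_def)

lemma add: "f \<in> ratfuns \<Longrightarrow> g \<in> ratfuns \<Longrightarrow> f \<noteq> 0 \<Longrightarrow> g \<noteq> 0 \<Longrightarrow> f + g \<noteq> 0 \<Longrightarrow>
    min (P f) (P g) \<le> P (f + g)"
  using point by (simp add: smooth_completion_def)

lemma P_const [simp]: "P (const c) = 0"
  using point by (cases "c = 0") (simp_all add: smooth_completion_def)

lemma outside: "f = 0 \<or> f \<notin> ratfuns \<Longrightarrow> P f = 0"
  using point unfolding smooth_completion_def by blast

lemma normalised: "\<exists>f\<in>ratfuns. f \<noteq> 0 \<and> P f = 1"
  using point by (simp add: smooth_completion_def)

lemma inverse: "f \<in> ratfuns \<Longrightarrow> P (inverse f) = - P f"
  using mult[of f "inverse f"] ratfuns_inverse[of f] P_const[of 1] outside[of 0]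
  by (cases "f = 0") auto

lemma divide: "f \<in> ratfuns \<Longrightarrow> g \<in> ratfuns \<Longrightarrow> f \<noteq> 0 \<Longrightarrow> g \<noteq> 0 \<Longrightarrow> P (f / g) = P f - P g"
  using mult[of f "inverse g"] inverse[of g] ratfuns_inverse[of g] by (simp add: divide_inverse)

lemma power_int:
  assumes "f \<in> ratfuns" "f \<noteq> 0"
  shows "P (f powi k) = k * P f"
proof -
  have power: "P (f ^ n) = int n * P f" for n
  proof (induction n)
    case (Suc n)
    have "f ^ n \<in> ratfuns"
      using ratfuns_power_int[OF assms(1), of "int n"] by simp
    then show ?case
      using Suc mult[of f "f ^ n"] assms by (simp add: algebra_simps)
  qed (use P_const[of 1] in simp)
  show ?thesis
  proof (cases "k \<ge> 0")
    case True
    then show ?thesis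
      using power[of "nat k"] by (simp add: power_int_def)
  next
    case False
    have "f ^ nat (- k) \<in> ratfuns"
      using ratfuns_power_int[OF assms(1), of "int (nat (- k))"] by (simp only: power_int_of_nat)
    then show ?thesis
      using False power[of "nat (- k)"] inverse by (simp add: power_int_def power_inverse)
  qed
qed

lemma prod:
  "(\<And>i. i \<in> A \<Longrightarrow> f i \<in> ratfuns \<and> f i \<noteq> 0) \<Longrightarrow> P (\<Prod>i\<in>A. f i) = (\<Sum>i\<in>A. P (f i))"
proof (induction A rule: infinite_finite_induct)
  case (insert x A)
  then have "P (f x * prod f A) = P (f x) + P (prod f A)"
    by (intro mult ratfuns_prod) auto
  then show ?case
    using insert by simp
qed (use P_const[of 1] in simp_all)

lemma minus: "f \<in> ratfuns \<Longrightarrow> P (- f) = P f"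
  using mult[OF ratfuns_const[of "- 1"]] P_const[of "- 1"]
  by (cases "f = 0") (auto simp: const_minus simp del: P_const)

lemma P_of_linear_neg:
  assumes "P gen < 0"
  shows "P (gen - const a) = P gen"
proof (cases "a = 0")
  case False
  have gen: "gen \<in> (ratfuns :: 'k universal set)" "gen \<noteq> (0 :: 'k universal)"
    by simp (simp add: gen_def)
  have nz: "gen - const a \<noteq> 0"
    unfolding of_poly_linear[symmetric] by simp
  have in_r: "gen - const a \<in> ratfuns" "- const a \<in> ratfuns"
    using gen by (simp_all add: ratfuns_diff ratfuns_minus)
  have "min (P gen) (P (- const a)) \<le> P (gen + - const a)"
    using False gen nz in_r by (intro add) auto
  moreover have "min (P (gen - const a)) (P (const a)) \<le> P (gen - const a + const a)"
    using False gen nz in_r by (intro add) auto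
  ultimately show ?thesis
    using assms by (auto simp: minus)
qed simp

end

text \<open>The roots \<open>A\<close> come from splitting p into linear factors and do not depend
  on \<open>P\<close>, so two points can be compared on the same factorisation.\<close>

lemma point_of_poly_eq_sum:
  fixes p :: "'k::alg_closed_field poly"
  assumes "p \<noteq> 0"
  obtains A where "\<And>P. point P \<Longrightarrow> P (of_poly p) = (\<Sum>a\<in>#A. P (gen - const a))"
proof -
  have nz: "(\<Prod>a\<in>#A. [:- a, 1:]) \<noteq> 0" for A :: "'k multiset"
    by (auto simp: prod_mset_zero_iff)
  obtain A where A: "p = Polynomial.smult (Polynomial.lead_coeff p) (\<Prod>a\<in>#A. [:- a, 1:])"
    using alg_closed_imp_factorization[OF assms] by blast
  have "P (of_poly p) = (\<Sum>a\<in>#A. P (gen - const a))" if "point P" for P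
  proof -
    interpret point P by fact
    have prod: "P (of_poly (\<Prod>a\<in>#A. [:- a, 1:])) = (\<Sum>a\<in>#A. P (gen - const a))" for A
    proof (induction A)
      case (add a A)
      have "of_poly (\<Prod>a\<in>#add_mset a A. [:- a, 1:]) = of_poly [:- a, 1:] * of_poly (\<Prod>a\<in>#A. [:- a, 1:])"
        by (simp del: mult_pCons_left flip: of_poly_mult)
      also have "P \<dots> = P (of_poly [:- a, 1:]) + P (of_poly (\<Prod>a\<in>#A. [:- a, 1:]))"
        by (intro mult) (use nz[of A] in simp_all)
      finally show ?case
        using add by (simp only: of_poly_linear image_mset_add_mset sum_mset.add_mset)
    qed (use P_const[of 1] in simp)
    have "of_poly p = const (Polynomial.lead_coeff p) * of_poly (\<Prod>a\<in>#A. [:- a, 1:])"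
      by (subst A) (simp add: const_eq_of_poly flip: of_poly_mult)
    also have "P \<dots> = P (const (Polynomial.lead_coeff p)) + P (of_poly (\<Prod>a\<in>#A. [:- a, 1:]))"
      by (intro mult) (use nz[of A] assms in simp_all)
    finally show ?thesis
      by (simp only: P_const prod add_0)
  qed
  then show ?thesis
    using that by blast
qed

text \<open>Linear factors determine a point, so \<open>P\<close> is k times \<open>place d\<close>
  everywhere; as \<open>P\<close> takes the value 1, k is 1.\<close>

lemma point_eq_place:
  fixes P :: "'k::alg_closed_field point"
  assumes "point P" "point (place d)" "multiplicative_order d" "0 < k"
    and linear: "\<And>a. P (gen - const a) = k * d [:- a, 1:]"
  shows "P = place d"
proof -
  interpret P: point P by fact
  interpret d: point "place d" by fact
  have "place d (gen - const a) = d [:- a, 1:]" for a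
    using place_of_poly[OF assms(3), of "[:- a, 1:]"] by (simp add: of_poly_linear)
  then have linear': "P (gen - const a) = k * place d (gen - const a)" for a
    using linear by simp
  have poly: "P (of_poly p) = k * place d (of_poly p)" if p: "p \<noteq> 0" for p
  proof (rule point_of_poly_eq_sum[OF p])
    fix A assume *: "\<And>P. point P \<Longrightarrow> P (of_poly p) = (\<Sum>a\<in>#A. P (gen - const a))"
    then show ?thesis
      unfolding *[OF assms(1)] *[OF assms(2)] linear' by (simp add: sum_mset_distrib_left)
  qed
  have eq: "P f = k * place d f" for f
  proof (cases "f \<in> ratfuns \<and> f \<noteq> 0")
    case True
    then obtain p q where pq: "q \<noteq> 0" "f = of_poly p / of_poly q" "p \<noteq> 0"
      by (metis ratfunsE div_0 of_poly_0)
    then show ?thesis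
      using poly by (simp add: P.divide d.divide algebra_simps)
  next
    case False
    then have "f = 0 \<or> f \<notin> ratfuns"
      by blast
    then show ?thesis
      using P.outside d.outside by simp
  qed
  obtain f where "P f = 1"
    using P.normalised by blast
  then have "k * place d f = 1"
    using eq by simp
  then have "k = 1"
    using \<open>0 < k\<close> by (simp add: zmult_eq_1_iff)
  then show ?thesis
    using eq by auto
qed

text \<open>A pole of the variable gives infinity. Otherwise \<open>P\<close> is nonnegative on all
  \<open>gen - const a\<close> and positive for exactly one a: if for none, \<open>P\<close> would
  be trivial, and if for two, a nonzero constant would have positive order.\<close>

lemma point_cases:
  fixes P :: "'k::alg_closed_field point"
  assumes "P \<in> smooth_completion ratfuns"
  shows "P = place_inf \<or> (\<exists>a. P = place_at a)"
proof -
  interpret point P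
    by unfold_locales fact
  have lin: "gen - const a \<in> ratfuns" "gen - const a \<noteq> 0" for a :: 'k
    unfolding of_poly_linear[symmetric] by simp_all
  show ?thesis
  proof (cases "P gen < 0")
    case True
    then have "P = place_inf"
      unfolding place_inf_def
      by (intro point_eq_place[of _ _ "- P gen"])
        (simp_all add: P_of_linear_neg multiplicative_order_degree point_def point
          place_inf_in_completion[unfolded place_inf_def])
    then show ?thesis ..
  next
    case False
    have diff: "min (P (gen - const a)) (P (const c)) \<le> P (gen - const (a - c))" for a c
    proof (cases "c = 0")
      case False
      then show ?thesis
        using add[of "gen - const a" "const c"] lin[of "a - c"] lin[of a]
        by (simp add: const_diff algebra_simps)
    qed simp
    have nonneg: "0 \<le> P (gen - const a)" for a
      using diff[of 0 "- a"] False by simp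
    have "\<exists>a. P (gen - const a) > 0"
    proof (rule ccontr)
      assume "\<not> ?thesis"
      then have zero: "P (gen - const a) = 0" for a
        using nonneg[of a] by (simp add: not_less order_antisym)
      have poly: "P (of_poly p) = 0" if p: "p \<noteq> 0" for p
      proof (rule point_of_poly_eq_sum[OF p])
        fix A assume *: "\<And>P. point P \<Longrightarrow> P (of_poly p) = (\<Sum>a\<in>#A. P (gen - const a))"
        then show ?thesis
          unfolding *[OF point_axioms] zero by simp
      qed
      obtain f where f: "f \<in> ratfuns" "f \<noteq> 0" "P f = 1"
        using normalised by blast
      then obtain p q where "q \<noteq> 0" "f = of_poly p / of_poly q" "p \<noteq> 0"
        by (metis ratfunsE div_0 of_poly_0)
      then show False
        using f(3) poly divide[of "of_poly p" "of_poly q"] by simp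
    qed
    then obtain a where a: "P (gen - const a) > 0"
      by blast
    have "P (gen - const b) = 0" if "b \<noteq> a" for b
    proof (rule ccontr)
      assume "P (gen - const b) \<noteq> 0"
      then have "0 < P (gen - const b)"
        using nonneg[of b] by simp
      moreover have "min (P (gen - const a)) (P (- (gen - const b))) \<le> P (gen - const a + - (gen - const b))"
        using lin[of a] lin[of b] ratfuns_minus[OF lin(1)[of b]] that by (intro add) auto
      moreover have "gen - const a + - (gen - const b) = const (b - a)"
        by (simp add: const_diff)
      ultimately show False
        using a minus[OF lin(1)[of b]] by simp
    qed
    then have "P = place_at a"
      unfolding place_at_def using a
      by (intro point_eq_place[of _ _ "P (gen - const a)"])
        (auto simp: order_linear multiplicative_order_order point_def point
          place_at_in_completion[unfolded place_at_def])
    then show ?thesis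
      by blast
  qed
qed

lemma smooth_completion_ratfuns:
  "smooth_completion (ratfuns :: 'k::alg_closed_field universal set) = insert place_inf (range place_at)"
  using point_cases place_at_in_completion place_inf_in_completion by blast


subsection \<open>The genus\<close>

text \<open>A root of q is also a root of p, and the common linear factor can be cancelled.\<close>

lemma dvd_if_order_le:
  fixes p q :: "'k::alg_closed_field poly"
  assumes "q \<noteq> 0" "\<And>a. Polynomial.order a q \<le> Polynomial.order a p"
  shows "q dvd p"
  using assms
proof (induction "Polynomial.degree q" arbitrary: p q rule: less_induct)
  case less
  show ?case
  proof (cases "p = 0 \<or> Polynomial.degree q = 0")
    case True
    then show ?thesis
      using less.prems(1) by (auto simp: is_unit_iff_degree intro: unit_imp_dvd)
  next
    case False
    then obtain a where a: "Polynomial.poly q a = 0"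
      using alg_closed_imp_poly_has_root by blast
    have "Polynomial.order a q \<noteq> 0"
      using a less.prems(1) by (simp add: order_root)
    then have "Polynomial.order a p \<noteq> 0"
      using less.prems(2)[of a] by linarith
    then have "Polynomial.poly p a = 0"
      by (simp add: order_root)
    then obtain p' q' where eq: "p = [:- a, 1:] * p'" "q = [:- a, 1:] * q'"
      using a by (metis dvdE poly_eq_0_iff_dvd)
    then have nz: "p' \<noteq> 0" "q' \<noteq> 0"
      using False less.prems(1) by auto
    have order: "Polynomial.order b ([:- a, 1:] * u) = Polynomial.order b [:- a, 1:] + Polynomial.order b u"
      if "u \<noteq> 0" for b u
      using that by (subst order_mult) (simp_all del: mult_pCons_left)
    have "Polynomial.degree q' < Polynomial.degree q"
      unfolding eq using nz by (subst degree_mult_eq) auto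
    moreover have "Polynomial.order b q' \<le> Polynomial.order b p'" for b
      using less.prems(2)[of b] nz unfolding eq by (simp add: order del: mult_pCons_left)
    ultimately have "q' dvd p'"
      using less.hyps nz by blast
    then show ?thesis
      unfolding eq by (rule mult_dvd_mono[OF dvd_refl])
  qed
qed

lemma ratfuns_regular_affine:
  fixes f :: "'k::alg_closed_field universal"
  assumes "f \<in> ratfuns" "\<And>a. 0 \<le> place_at a f"
  obtains p where "f = of_poly p"
proof -
  obtain p q where pq: "q \<noteq> 0" "f = of_poly p / of_poly q"
    using assms(1) by (rule ratfunsE)
  show ?thesis
  proof (cases "p = 0")
    case True
    then show ?thesis
      using that[of 0] pq by simp
  next
    case False
    have "q dvd p"
      using assms(2) pq False by (intro dvd_if_order_le) (simp_all add: place_at_divide)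
    then obtain u where "p = q * u"
      by (rule dvdE)
    then show ?thesis
      using that[of u] pq by (simp add: of_poly_mult)
  qed
qed

interpretation universal: vector_space "\<lambda>(c :: 'k::field) f. const c * f"
  by (rule vector_space_universal)

lemma dim_polynomials_over:
  fixes g :: "'k::field universal"
  assumes "g \<noteq> 0"
  shows "universal.dim ((\<lambda>p. of_poly p / g) ` {p. Polynomial.degree p \<le> n}) = Suc n"
proof (rule universal.dim_unique)
  let ?b = "\<lambda>k. of_poly (Polynomial.monom 1 k) / g"
  have inj: "inj_on ?b {..n}"
    using assms by (auto simp: inj_on_def monom_eq_iff')
  then show "card (?b ` {..n}) = Suc n"
    by (simp add: card_image)
  show "?b ` {..n} \<subseteq> (\<lambda>p. of_poly p / g) ` {p. Polynomial.degree p \<le> n}"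
    by (auto intro!: imageI simp: degree_monom_eq)
  have comb: "(\<Sum>k\<le>n. const (c k) * ?b k) = of_poly (\<Sum>k\<le>n. Polynomial.monom (c k) k) / g" for c
    by (simp add: of_poly_sum sum_divide_distrib const_eq_of_poly smult_monom flip: of_poly_mult)
  show "(\<lambda>p. of_poly p / g) ` {p. Polynomial.degree p \<le> n} \<subseteq> universal.span (?b ` {..n})"
  proof clarify
    fix p :: "'k poly" assume "Polynomial.degree p \<le> n"
    then have "(\<Sum>k\<le>n. Polynomial.monom (Polynomial.coeff p k) k) = p"
      by (rule poly_as_sum_of_monoms')
    then have "of_poly p / g = (\<Sum>k\<le>n. const (Polynomial.coeff p k) * ?b k)"
      using comb by simp
    also have "\<dots> \<in> universal.span (?b ` {..n})"
      by (intro universal.span_sum universal.span_scale universal.span_base) auto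
    finally show "of_poly p / g \<in> universal.span (?b ` {..n})" .
  qed
  show "universal.independent (?b ` {..n})"
  proof (rule universal.independent_if_scalars_zero)
    fix c x assume sum: "(\<Sum>x\<in>?b ` {..n}. const (c x) * x) = 0" and "x \<in> ?b ` {..n}"
    then obtain k where k: "k \<le> n" "x = ?b k"
      by blast
    have "(\<Sum>k\<le>n. const (c (?b k)) * ?b k) = 0"
      using sum inj by (simp add: sum.reindex)
    then have "(\<Sum>k\<le>n. Polynomial.monom (c (?b k)) k) = 0"
      unfolding comb using assms by simp
    then have "Polynomial.coeff (\<Sum>k\<le>n. Polynomial.monom (c (?b k)) k) k = 0"
      by simp
    then show "c x = 0"
      using k by (simp add: coeff_sum)
  qed simp
qed

lemma gen_minus_const [simp]: "gen - const a \<in> ratfuns" "gen \<noteq> const a"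
  using of_poly_linear[of a] of_poly_eq_0_iff[of "[:- a, 1:]"] ratfuns_of_poly[of "[:- a, 1:]"]
  by auto

text \<open>The product g of the powers \<open>(gen - const a) powi D (place_at a)\<close> has
  divisor \<open>D\<close> on the affine line and order \<open>D place_inf - d\<close> at infinity.
  So f lies in the space iff f g is a polynomial whose pole order at infinity, its degree, is at
  most d. The zero polynomial is listed separately because d may be negative while its formal degree
  is 0.\<close>

lemma riemann_roch_space_ratfuns:
  fixes D :: "'k::alg_closed_field point \<Rightarrow> int"
  assumes "D \<in> divisors ratfuns"
  defines "d \<equiv> \<Sum>P | D P \<noteq> 0. D P"
  obtains g where "g \<noteq> 0"
    "riemann_roch_space ratfuns D = (\<lambda>p. of_poly p / g) ` {p. p = 0 \<or> int (Polynomial.degree p) \<le> d}"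
proof -
  define A where "A = {a. D (place_at a) \<noteq> 0}"
  have fin: "finite {P. D P \<noteq> 0}" and sub: "{P. D P \<noteq> 0} \<subseteq> smooth_completion ratfuns"
    using assms by (auto simp: divisors_def)
  have "finite A"
    using fin finite_vimageI[of "{P. D P \<noteq> 0}" place_at] by (simp add: A_def vimage_def inj_def)
  have "d = (\<Sum>P\<in>insert place_inf (place_at ` A). D P)"
    unfolding d_def using fin sub \<open>finite A\<close>
    by (intro sum.mono_neutral_left) (auto simp: A_def smooth_completion_ratfuns)
  also have "\<dots> = D place_inf + (\<Sum>a\<in>A. D (place_at a))"
    using \<open>finite A\<close> by (simp add: image_iff sum.reindex inj_on_def)
  finally have d: "d = D place_inf + (\<Sum>a\<in>A. D (place_at a))" .
  define g where "g = (\<Prod>a\<in>A. (gen - const a) powi D (place_at a))"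
  have g: "g \<in> ratfuns" "g \<noteq> 0"
    using \<open>finite A\<close> by (auto simp: g_def intro!: ratfuns_prod ratfuns_power_int)
  have P_g: "P g = (\<Sum>a\<in>A. D (place_at a) * P (gen - const a))" if "P \<in> smooth_completion ratfuns" for P
  proof -
    interpret point P
      using that by (rule point.intro)
    show ?thesis
      unfolding g_def by (subst prod) (simp_all add: power_int ratfuns_power_int)
  qed
  have at_g: "place_at b g = D (place_at b)" for b
  proof -
    have "place_at b g = (\<Sum>a\<in>A. if b = a then D (place_at a) else 0)"
      unfolding P_g[OF place_at_in_completion] by (intro sum.cong) (auto simp: place_at_linear)
    also have "\<dots> = D (place_at b)"
      using \<open>finite A\<close> by (simp add: A_def)
    finally show ?thesis .
  qed
  have inf_g: "place_inf g = D place_inf - d"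
    unfolding P_g[OF place_inf_in_completion] d by (simp add: place_inf_linear sum_negf)
  have div: "P (f / g) = P f - P g" if "P \<in> smooth_completion ratfuns" "f \<in> ratfuns" "f \<noteq> 0" for P f
    using point.divide[OF point.intro[OF that(1)] that(2) g(1) that(3) g(2)] .
  have mult: "P (f * g) = P f + P g" if "P \<in> smooth_completion ratfuns" "f \<in> ratfuns" "f \<noteq> 0" for P f
    using point.mult[OF point.intro[OF that(1)] that(2) g(1) that(3) g(2)] .
  have "f \<in> riemann_roch_space ratfuns D \<longleftrightarrow>
      f \<in> (\<lambda>p. of_poly p / g) ` {p. p = 0 \<or> int (Polynomial.degree p) \<le> d}" for f
  proof
    assume f: "f \<in> riemann_roch_space ratfuns D"
    show "f \<in> (\<lambda>p. of_poly p / g) ` {p. p = 0 \<or> int (Polynomial.degree p) \<le> d}"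
    proof (cases "f = 0")
      case True
      then show ?thesis
        by (intro image_eqI[of _ _ 0]) simp_all
    next
      case False
      then have f': "f \<in> ratfuns" and ge: "\<And>P. P \<in> smooth_completion ratfuns \<Longrightarrow> P f + D P \<ge> 0"
        using f by (auto simp: riemann_roch_space_def)
      have "0 \<le> place_at a (f * g)" for a
        using ge[OF place_at_in_completion, of a]
        by (simp add: mult[OF place_at_in_completion f' False] at_g)
      then obtain p where p: "f * g = of_poly p"
        using ratfuns_regular_affine ratfuns_mult[OF f' g(1)] by blast
      then have "p \<noteq> 0"
        using False g by auto
      have "place_inf (f * g) + d \<ge> 0"
        using ge[OF place_inf_in_completion]
        by (simp add: mult[OF place_inf_in_completion f' False] inf_g)
      then have "int (Polynomial.degree p) \<le> d"
        unfolding p using \<open>p \<noteq> 0\<close> by (simp add: place_inf_of_poly)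
      moreover have "f = of_poly p / g"
        using p g by (simp add: field_simps)
      ultimately show ?thesis
        by blast
    qed
  next
    assume "f \<in> (\<lambda>p. of_poly p / g) ` {p. p = 0 \<or> int (Polynomial.degree p) \<le> d}"
    then obtain p where p: "f = of_poly p / g" "p = 0 \<or> int (Polynomial.degree p) \<le> d"
      by blast
    have "0 \<le> P f + D P" if P: "P \<in> smooth_completion ratfuns" "p \<noteq> 0" for P
      using P p(2) unfolding p(1)
      by (auto simp: smooth_completion_ratfuns div place_at_in_completion place_inf_in_completion
          at_g inf_g place_at_of_poly place_inf_of_poly)
    then show "f \<in> riemann_roch_space ratfuns D"
      using p(1) ratfuns_divide[OF ratfuns_of_poly g(1)] by (auto simp: riemann_roch_space_def)
  qed
  then show ?thesis
    using that[of g] g(2) by blast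
qed

text \<open>A divisor of degree \<open>d \<ge> 0\<close> has a space of dimension d + 1 and
  contributes exactly 0, for example \<open>D = 0\<close>. One of negative degree contributes at
  most \<open>d + 1 \<le> 0\<close>.\<close>

lemma genus_ratfuns: "genus (ratfuns :: 'k::alg_closed_field universal set) = 0"
proof -
  define e where "e D = (\<Sum>P | D P \<noteq> 0. D P)
    - int (universal.dim (riemann_roch_space ratfuns D)) + 1" for D :: "'k point \<Rightarrow> int"
  have dim: "universal.dim (riemann_roch_space ratfuns D) = Suc (nat (\<Sum>P | D P \<noteq> 0. D P))"
    if D: "D \<in> divisors ratfuns" "(\<Sum>P | D P \<noteq> 0. D P) \<ge> 0" for D :: "'k point \<Rightarrow> int"
  proof -
    obtain g where g: "g \<noteq> 0" "riemann_roch_space ratfuns D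
        = (\<lambda>p. of_poly p / g) ` {p. p = 0 \<or> int (Polynomial.degree p) \<le> (\<Sum>P | D P \<noteq> 0. D P)}"
      using riemann_roch_space_ratfuns[OF D(1)] by blast
    have "{p :: 'k poly. p = 0 \<or> int (Polynomial.degree p) \<le> (\<Sum>P | D P \<noteq> 0. D P)}
        = {p. Polynomial.degree p \<le> nat (\<Sum>P | D P \<noteq> 0. D P)}"
      using D(2) by (auto simp: le_nat_iff)
    then show ?thesis
      unfolding g(2) using dim_polynomials_over[OF g(1)] by simp
  qed
  have le: "e D \<le> 0" if "D \<in> divisors ratfuns" for D
  proof (cases "(\<Sum>P | D P \<noteq> 0. D P) \<ge> 0")
    case True
    then show ?thesis
      using dim[OF that] by (simp add: e_def)
  qed (simp add: e_def)
  have zero: "(\<lambda>_. 0) \<in> divisors ratfuns" "e (\<lambda>_. 0) = 0"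
    using dim[of "\<lambda>_. 0"] by (simp_all add: divisors_def e_def)
  have "(SUP D\<in>divisors ratfuns. e D) = 0"
  proof (rule cSup_eq_maximum)
    show "0 \<in> e ` divisors ratfuns"
      using zero by force
  qed (use le in auto)
  then show ?thesis
    by (simp add: genus_def e_def)
qed


subsection \<open>Values of functions\<close>

context point
begin

text \<open>The vanishing alternatives are carried along because a point takes the value 0, not
  infinity, at the zero function.\<close>

lemma pos_add:
  assumes "f \<in> ratfuns" "g \<in> ratfuns" "f = 0 \<or> P f > 0" "g = 0 \<or> P g > 0"
  shows "f + g = 0 \<or> P (f + g) > 0"
  using add[OF assms(1,2)] assms(3,4) by (cases "f = 0"; cases "g = 0"; cases "f + g = 0") auto

lemma pos_mult:
  assumes "f \<in> ratfuns" "g \<in> ratfuns" "f = 0 \<or> P f > 0" "g = 0 \<or> P g \<ge> 0"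
  shows "f * g = 0 \<or> P (f * g) > 0"
  using mult[OF assms(1,2)] assms(3,4) by (cases "f = 0"; cases "g = 0") auto

lemma has_value_iff: "has_value P f x \<longleftrightarrow> f - const x = 0 \<or> P (f - const x) > 0"
  by (simp add: has_value_def)

lemma has_value_const [simp]: "has_value P (const x) x"
  by (simp add: has_value_def)

lemma has_value_diff:
  assumes "f \<in> ratfuns" "g \<in> ratfuns" "has_value P f x" "has_value P g y"
  shows "has_value P (f - g) (x - y)"
proof -
  have eq: "f - g - const (x - y) = (f - const x) + - (g - const y)"
    by (simp add: const_diff)
  have "g - const y \<in> ratfuns"
    using assms by (simp add: ratfuns_diff)
  then show ?thesis
    using assms unfolding has_value_iff eq
    by (intro pos_add) (auto simp: ratfuns_diff minus simp del: minus_diff_eq intro: ratfuns_minus)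
qed

lemma has_value_nonneg:
  assumes "f \<in> ratfuns" "has_value P f x"
  shows "f = 0 \<or> P f \<ge> 0"
  using add[of "f - const x" "const x"] assms ratfuns_diff[of f "const x"]
  by (cases "x = 0"; cases "f = 0"; cases "f = const x") (auto simp: has_value_iff)

lemma has_value_unique:
  assumes "f \<in> ratfuns" "has_value P f x" "has_value P f y"
  shows "x = y"
  using has_value_diff[OF assms(1,1,2,3)] minus[of "const (x - y)"] by (auto simp: has_value_iff)

lemma has_value_nonzero:
  assumes "f \<in> ratfuns" "has_value P f x" "x \<noteq> 0"
  shows "f \<noteq> 0" "P f = 0"
proof -
  show "f \<noteq> 0"
    using has_value_unique[OF assms(1,2), of 0] assms by (auto simp: has_value_def)
  moreover have "\<not> P f > 0"
    using has_value_unique[OF assms(1,2), of 0] assms by (auto simp: has_value_def)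
  ultimately show "P f = 0"
    using has_value_nonneg[OF assms(1,2)] by auto
qed

lemma has_value_mult:
  assumes "f \<in> ratfuns" "g \<in> ratfuns" "has_value P f x" "has_value P g y"
  shows "has_value P (f * g) (x * y)"
proof -
  have eq: "f * g - const (x * y) = (f - const x) * g + (g - const y) * const x"
    by (simp add: const_mult algebra_simps)
  have "(f - const x) * g = 0 \<or> P ((f - const x) * g) > 0"
    using assms has_value_nonneg[of g y] by (intro pos_mult) (simp_all add: ratfuns_diff has_value_iff)
  moreover have "(g - const y) * const x = 0 \<or> P ((g - const y) * const x) > 0"
    using assms by (intro pos_mult) (simp_all add: ratfuns_diff has_value_iff)
  ultimately show ?thesis
    unfolding has_value_iff eq using assms
    by (intro pos_add) (simp_all add: ratfuns_diff ratfuns_mult)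
qed

lemma has_value_inverse:
  assumes "f \<in> ratfuns" "has_value P f x" "x \<noteq> 0"
  shows "has_value P (inverse f) (inverse x)"
proof -
  note nz = has_value_nonzero[OF assms]
  have eq: "inverse f - const (inverse x) = (f - const x) * (inverse f * const (- inverse x))"
    using nz(1) assms(3) unfolding const_minus const_inverse by (simp add: field_simps)
  have in_r: "inverse f \<in> ratfuns"
    using assms(1) by (rule ratfuns_inverse)
  have "P (inverse f * const (- inverse x)) = 0"
    using nz assms in_r by (simp add: mult inverse)
  then show ?thesis
    unfolding has_value_iff eq using assms in_r
    by (intro pos_mult) (simp_all add: ratfuns_diff ratfuns_mult has_value_iff)
qed

lemma has_value_power_int:
  assumes "f \<in> ratfuns" "has_value P f x" "x \<noteq> 0"
  shows "has_value P (f powi k) (x powi k)"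
proof -
  have pow_in: "f ^ n \<in> ratfuns" for n
    using ratfuns_power_int[OF assms(1), of "int n"] by simp
  have power: "has_value P (f ^ n) (x ^ n)" for n
  proof (induction n)
    case (Suc n)
    then show ?case
      using has_value_mult[OF assms(1) pow_in assms(2)] by simp
  qed (use has_value_const[of 1] in simp)
  show ?thesis
    using power[of "nat k"] has_value_inverse[OF pow_in power, of "nat (- k)"] assms(3)
    by (simp add: power_int_def power_inverse)
qed

lemma has_value_prod:
  assumes "\<And>i. i \<in> A \<Longrightarrow> f i \<in> ratfuns \<and> has_value P (f i) (x i)"
  shows "has_value P (\<Prod>i\<in>A. f i) (\<Prod>i\<in>A. x i)"
  using assms
proof (induction A rule: infinite_finite_induct)
  case (insert j A)
  then show ?case
    by (simp add: has_value_mult ratfuns_prod)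
qed (use has_value_const[of 1] in simp_all)

end

lemma point_place_at: "point (place_at a)"
  by (rule point.intro) (rule place_at_in_completion)

lemma point_place_inf: "point place_inf"
  by (rule point.intro) (rule place_inf_in_completion)

lemma has_value_place_at_linear: "has_value (place_at z) (gen - const b) (z - b)"
  by (simp add: has_value_def const_diff place_at_linear)

lemma has_value_place_inf_ratio: "has_value place_inf ((gen - const b) / gen) 1"
proof -
  interpret point place_inf
    by (rule point_place_inf)
  have gen: "gen \<noteq> (0 :: 'a universal)"
    using gen_minus_const(2)[of 0] by simp
  have eq: "(gen - const b) / gen - const 1 = const (- b) / gen"
    using gen by (simp add: const_minus field_simps)
  have "place_inf (const (- b) / gen) = 1" if "b \<noteq> 0"
    using that gen place_inf_linear[of 0] by (simp add: divide)
  then show ?thesis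
    unfolding has_value_iff eq by (cases "b = 0") auto
qed

text \<open>Over a finite field the product of all X - x, plus 1, would have no root.\<close>

lemma infinite_alg_closed: "infinite (UNIV :: 'k::alg_closed_field set)"
proof
  assume fin: "finite (UNIV :: 'k set)"
  let ?P = "\<Prod>x\<in>UNIV. [:- x :: 'k, 1:]"
  have "Polynomial.degree ?P = card (UNIV :: 'k set)"
    using degree_prod_eq_sum_degree[of UNIV "\<lambda>x :: 'k. [:- x, 1:]"] by simp
  then have "Polynomial.degree (?P + 1) > 0"
    using fin by (subst degree_add_eq_left) (auto simp: card_gt_0_iff)
  then obtain z where "Polynomial.poly (?P + 1) z = 0"
    using alg_closed_imp_poly_has_root by blast
  moreover have "(\<Prod>x\<in>UNIV. z - x) = 0"
    using fin by (intro prod_zero) auto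
  ultimately show False
    by (simp add: poly_prod)
qed

text \<open>A nonzero difference would vanish at all but finitely many of the infinitely many points
  of the line. This gives meaning to the description operator in \<open>pullback\<close>.\<close>

lemma is_pullback_unique:
  fixes U :: "'k::alg_closed_field point set"
  assumes "smooth_curve ratfuns U" "is_pullback ratfuns U \<phi> l f" "is_pullback ratfuns U \<phi> l g"
  shows "f = g"
proof (rule ccontr)
  assume "f \<noteq> g"
  have fg: "f \<in> ratfuns" "g \<in> ratfuns"
    using assms by (auto simp: is_pullback_def regular_functions_def)
  have "place_at a (f - g) \<noteq> 0" if a: "place_at a \<in> U" for a
  proof -
    interpret point "place_at a"
      by (rule point_place_at)
    have "has_value (place_at a) (f - g) (\<phi> (place_at a) l - \<phi> (place_at a) l)"
      using assms a fg by (intro has_value_diff) (auto simp: is_pullback_def)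
    then show ?thesis
      using \<open>f \<noteq> g\<close> by (auto simp: has_value_def)
  qed
  then have "UNIV \<subseteq> {a. place_at a (f - g) \<noteq> 0} \<union> place_at -` (smooth_completion ratfuns - U)"
    using place_at_in_completion by auto
  moreover have "finite (place_at -` (smooth_completion ratfuns - U))"
    using assms(1) by (intro finite_vimageI) (auto simp: smooth_curve_def inj_def)
  ultimately show False
    using infinite_alg_closed finite_zeros_and_poles[of "f - g"]
    by (meson finite_UnI finite_subset)
qed


subsection \<open>Maps from the punctured line to a torus\<close>

lemma pairing_add_left: "pairing (l + l') x = pairing l x + pairing l' x"
  by (simp add: pairing_def sum.distrib algebra_simps)

lemma pairing_add_right: "pairing l (x + y) = pairing l x + pairing l y"
  by (simp add: pairing_def sum.distrib algebra_simps)

lemma pairing_scale_right: "pairing l (t *s x) = t * pairing l x"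
  by (simp add: pairing_def sum_distrib_left algebra_simps)

lemma pairing_0_right [simp]: "pairing l 0 = 0"
  by (simp add: pairing_def)

lemma pairing_sum_right: "pairing l (\<Sum>i\<in>A. x i) = (\<Sum>i\<in>A. pairing l (x i))"
  by (induction A rule: infinite_finite_induct) (simp_all add: pairing_add_right)

lemma pairing_rat_vec: "pairing l (rat_vec s) = of_int (pairing l s)"
  by (simp add: pairing_def rat_vec_def)

lemma pairing_axis: "pairing (axis i 1) x = x $ i"
proof -
  have "pairing (axis i 1) x = (\<Sum>j\<in>UNIV. if j = i then x $ j else 0)"
    unfolding pairing_def by (intro sum.cong) (auto simp: axis_def)
  then show ?thesis
    by simp
qed

lemma pairing_eqI: "(\<And>l. pairing l x = pairing l y) \<Longrightarrow> x = y"
  by (metis pairing_axis vec_eq_iff)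

text \<open>Resolves the description operators in \<open>order_vec\<close> and
  \<open>torus_valuation\<close>.\<close>

lemma the_pairing: "(THE y. \<forall>l. pairing l y = pairing l x) = x"
  by (rule the_equality) (auto intro: pairing_eqI)

text \<open>The exponents \<open>s i\<close> sum to zero so that infinity can stay in the curve, and
  each is nonzero so that the map does not extend to the removed points.\<close>

locale punctured_line =
  fixes I :: "'c set" and a :: "'c \<Rightarrow> 'k::alg_closed_field" and s :: "'c \<Rightarrow> int ^ 'n"
    and c :: "'n \<Rightarrow> 'k"
  assumes finite_I: "finite I"
    and inj_a: "inj_on a I"
    and s_nonzero: "i \<in> I \<Longrightarrow> s i \<noteq> 0"
    and s_sum: "(\<Sum>i\<in>I. s i) = 0"
    and c_nonzero: "c j \<noteq> 0"
begin

definition U :: "'k point set" where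
  "U = smooth_completion ratfuns - place_at ` a ` I"

definition base :: "int ^ 'n \<Rightarrow> 'k" where
  "base l = (\<Prod>j\<in>UNIV. c j powi (l $ j))"

definition monomial :: "int ^ 'n \<Rightarrow> 'k universal" where
  "monomial l = const (base l) * (\<Prod>i\<in>I. (gen - const (a i)) powi pairing l (s i))"

text \<open>Defined by the value of the monomial instead of the product formula, so that infinity is
  covered as well.\<close>

definition \<phi> :: "'k point \<Rightarrow> int ^ 'n \<Rightarrow> 'k" where
  "\<phi> P l = (THE x. has_value P (monomial l) x)"

lemma base_nonzero [simp]: "base l \<noteq> 0"
  using c_nonzero by (simp add: base_def)

lemma base_add: "base (l + l') = base l * base l'"
  using c_nonzero by (simp add: base_def power_int_add prod.distrib)

lemma monomial_in [simp]: "monomial l \<in> ratfuns"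
  unfolding monomial_def by (intro ratfuns_mult ratfuns_prod ratfuns_power_int) simp_all

lemma monomial_add: "monomial (l + l') = monomial l * monomial l'"
  by (simp add: monomial_def base_add const_mult pairing_add_left power_int_add prod.distrib)

lemma completion_diff_U: "smooth_completion ratfuns - U = place_at ` a ` I"
  using place_at_in_completion by (auto simp: U_def)

lemma U_cases:
  assumes "P \<in> U"
  obtains "P = place_inf" | z where "P = place_at z" "z \<notin> a ` I"
  using assms by (auto simp: U_def smooth_completion_ratfuns)

lemma place_in_U: "place_inf \<in> U" "z \<notin> a ` I \<Longrightarrow> place_at z \<in> U"
  using place_at_in_completion place_inf_in_completion by (auto simp: U_def)

lemma smooth_curve: "smooth_curve ratfuns U"
  using function_field_ratfuns finite_I completion_diff_U by (auto simp: smooth_curve_def U_def)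

lemma has_value_place_at:
  assumes "z \<notin> a ` I"
  shows "has_value (place_at z) (monomial l) (base l * (\<Prod>i\<in>I. (z - a i) powi pairing l (s i)))"
proof -
  interpret point "place_at z"
    by (rule point_place_at)
  have "has_value (place_at z) ((gen - const (a i)) powi pairing l (s i)) ((z - a i) powi pairing l (s i))"
    if "i \<in> I" for i
    using that assms has_value_place_at_linear by (intro has_value_power_int) auto
  then show ?thesis
    unfolding monomial_def
    by (intro has_value_mult has_value_prod) (auto intro!: ratfuns_prod ratfuns_power_int)
qed

text \<open>As the exponents sum to zero, every factor may be divided by the variable without
  changing the product, and each of these ratios has value 1 at infinity.\<close>

lemma has_value_place_inf: "has_value place_inf (monomial l) (base l)"
proof -
  interpret point place_inf
    by (rule point_place_inf)
  have gen: "gen \<noteq> (0 :: 'k universal)"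
    using gen_minus_const(2)[of 0] by simp
  have "(\<Prod>i\<in>A. gen powi pairing l (s i)) = (gen :: 'k universal) powi (\<Sum>i\<in>A. pairing l (s i))" for A
    by (induction A rule: infinite_finite_induct) (simp_all add: power_int_add gen)
  moreover have "(\<Sum>i\<in>I. pairing l (s i)) = 0"
    by (simp add: s_sum flip: pairing_sum_right)
  ultimately have eq: "monomial l = const (base l) * (\<Prod>i\<in>I. ((gen - const (a i)) / gen) powi pairing l (s i))"
    by (simp add: monomial_def power_int_divide_distrib prod_dividef)
  have ratio: "(gen - const (a i)) / gen \<in> ratfuns" for i
    by (intro ratfuns_divide) simp_all
  have "has_value place_inf (((gen - const (a i)) / gen) powi pairing l (s i)) (1 powi pairing l (s i))" for i
    using ratio has_value_place_inf_ratio by (intro has_value_power_int) auto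
  then have "has_value place_inf (monomial l) (base l * (\<Prod>i\<in>I. 1))"
    unfolding eq using ratio
    by (intro has_value_mult has_value_prod) (auto intro!: ratfuns_prod ratfuns_power_int)
  then show ?thesis
    by simp
qed

lemma point_U: "P \<in> U \<Longrightarrow> point P"
  by (rule point.intro) (simp add: U_def)

lemma \<phi>_eqI: "P \<in> U \<Longrightarrow> has_value P (monomial l) x \<Longrightarrow> \<phi> P l = x"
  unfolding \<phi>_def by (rule the_equality) (auto intro: point.has_value_unique[OF point_U monomial_in])

lemma \<phi>_place_at: "z \<notin> a ` I \<Longrightarrow> \<phi> (place_at z) l = base l * (\<Prod>i\<in>I. (z - a i) powi pairing l (s i))"
  by (rule \<phi>_eqI) (auto intro: place_in_U has_value_place_at)

lemma \<phi>_place_inf: "\<phi> place_inf l = base l"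
  by (rule \<phi>_eqI) (auto intro: place_in_U has_value_place_inf)

lemma
  assumes "P \<in> U"
  shows has_value_\<phi>: "has_value P (monomial l) (\<phi> P l)" and \<phi>_nonzero: "\<phi> P l \<noteq> 0"
proof -
  have "has_value P (monomial l) (\<phi> P l) \<and> \<phi> P l \<noteq> 0"
    using assms
  proof (cases rule: U_cases)
    case (2 z)
    then show ?thesis
      using has_value_place_at[of z l] finite_I by (auto simp: \<phi>_place_at power_int_eq_0_iff)
  qed (simp add: \<phi>_place_inf has_value_place_inf)
  then show "has_value P (monomial l) (\<phi> P l)" "\<phi> P l \<noteq> 0"
    by blast+
qed

lemma \<phi>_in_torus:
  assumes "P \<in> U"
  shows "\<phi> P \<in> torus"
proof -
  interpret point P
    using assms by (rule point_U)
  have "\<phi> P (l + l') = \<phi> P l * \<phi> P l'" for l l'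
    using has_value_mult[OF _ _ has_value_\<phi>[OF assms, of l] has_value_\<phi>[OF assms, of l']]
    by (intro \<phi>_eqI[OF assms]) (simp add: monomial_add)
  then show ?thesis
    using \<phi>_nonzero[OF assms] by (simp add: torus_def)
qed

lemma is_pullback_monomial: "is_pullback ratfuns U \<phi> l (monomial l)"
proof -
  have "0 \<le> P (monomial l)" if "P \<in> U" for P
    by (rule eq_refl[OF point.has_value_nonzero(2)[symmetric]])
      (rule point_U[OF that] monomial_in has_value_\<phi>[OF that] \<phi>_nonzero[OF that])+
  then show ?thesis
    using has_value_\<phi> by (simp add: is_pullback_def regular_functions_def)
qed

lemma torus_map: "torus_map ratfuns U \<phi>"
  using \<phi>_in_torus is_pullback_monomial by (auto simp: torus_map_def)

lemma pullback_eq: "pullback ratfuns U \<phi> l = monomial l"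
  unfolding pullback_def
  by (rule the_equality) (auto intro: is_pullback_monomial is_pullback_unique[OF smooth_curve])

text \<open>The points \<open>a i\<close> are distinct, so only the factor belonging to j has
  nonzero order at \<open>a j\<close>.\<close>

lemma place_at_monomial:
  assumes "j \<in> I"
  shows "place_at (a j) (monomial l) = pairing l (s j)"
proof -
  interpret point "place_at (a j)"
    by (rule point_place_at)
  have in_r: "(\<Prod>i\<in>I. (gen - const (a i)) powi pairing l (s i)) \<in> ratfuns"
    by (intro ratfuns_prod ratfuns_power_int) simp
  have "place_at (a j) (monomial l) = place_at (a j) (\<Prod>i\<in>I. (gen - const (a i)) powi pairing l (s i))"
    unfolding monomial_def using in_r finite_I by (subst mult) (simp_all add: power_int_eq_0_iff)
  also have "\<dots> = (\<Sum>i\<in>I. pairing l (s i) * place_at (a j) (gen - const (a i)))"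
    by (subst prod) (simp_all add: power_int ratfuns_power_int)
  also have "\<dots> = (\<Sum>i\<in>I. if i = j then pairing l (s i) else 0)"
    using inj_a assms by (intro sum.cong) (auto simp: place_at_linear inj_on_def)
  finally show ?thesis
    using finite_I assms by simp
qed

lemma order_vec_eq: "j \<in> I \<Longrightarrow> order_vec ratfuns U \<phi> (place_at (a j)) = s j"
  by (simp add: order_vec_def pullback_eq place_at_monomial the_pairing)

text \<open>By uniqueness of pullbacks an extension would pull characters back to the same
  monomials. Their values at x being nonzero, all orders \<open>pairing l (s j)\<close> would be 0,
  and hence \<open>s j\<close> too.\<close>

lemma not_extends:
  assumes "x \<in> smooth_completion ratfuns - U"
  shows "\<not> extends_to ratfuns U \<phi> x"
proof
  assume "extends_to ratfuns U \<phi> x"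
  then obtain \<psi> where \<psi>: "torus_map ratfuns (insert x U) \<psi>" "\<And>P. P \<in> U \<Longrightarrow> \<psi> P = \<phi> P"
    by (auto simp: extends_to_def)
  obtain j where j: "j \<in> I" "x = place_at (a j)"
    using assms unfolding completion_diff_U by blast
  have "pairing l (s j) = 0" for l
  proof -
    obtain f where f: "is_pullback ratfuns (insert x U) \<psi> l f"
      using \<psi>(1) by (auto simp: torus_map_def)
    then have "is_pullback ratfuns U \<phi> l f"
      using \<psi>(2) by (auto simp: is_pullback_def regular_functions_def)
    then have "f = monomial l"
      using is_pullback_unique[OF smooth_curve] is_pullback_monomial by blast
    moreover have "has_value x f (\<psi> x l)" "\<psi> x l \<noteq> 0"
      using f \<psi>(1) by (auto simp: is_pullback_def torus_map_def torus_def)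
    ultimately have "x (monomial l) = 0"
      using point.has_value_nonzero(2)[OF point_place_at monomial_in] j(2) by blast
    then show ?thesis
      using place_at_monomial j by simp
  qed
  then have "s j = 0"
    by (intro pairing_eqI) simp
  then show False
    using s_nonzero j by blast
qed

lemma curve_degree_eq:
  "curve_degree ratfuns U \<phi>
    = (\<lambda>r. \<Sum>i | i \<in> I \<and> primitive_part (s i) = r. s i) ` (\<lambda>i. primitive_part (s i)) ` I"
proof -
  let ?\<sigma> = "order_vec ratfuns U \<phi>"
  have "(\<Sum>x | x \<in> place_at ` a ` I \<and> primitive_part (?\<sigma> x) = r. ?\<sigma> x)
      = (\<Sum>i | i \<in> I \<and> primitive_part (s i) = r. s i)" for r
  proof -
    have "{x \<in> place_at ` a ` I. primitive_part (?\<sigma> x) = r}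
        = (\<lambda>i. place_at (a i)) ` {i \<in> I. primitive_part (s i) = r}"
      using order_vec_eq by (auto simp: image_iff)
    moreover have "inj_on (\<lambda>i. place_at (a i)) {i \<in> I. primitive_part (s i) = r}"
      using inj_a by (auto simp: inj_on_def)
    ultimately show ?thesis
      using order_vec_eq by (simp add: sum.reindex)
  qed
  moreover have "(\<lambda>x. primitive_part (?\<sigma> x)) ` place_at ` a ` I = (\<lambda>i. primitive_part (s i)) ` I"
    using order_vec_eq by (auto simp: image_image intro!: image_cong)
  ultimately show ?thesis
    by (simp add: curve_degree_def Let_def completion_diff_U)
qed

lemma Trop_eq:
  assumes "valued_field w" and q: "\<And>j. w (c j) = q $ j"
  shows "Trop w U \<phi> = insert q ((\<lambda>z. q + (\<Sum>i\<in>I. w (z - a i) *s rat_vec (s i))) ` (- a ` I))"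
proof -
  interpret valued_field w by fact
  have base: "w (base l) = pairing l q" for l
    using c_nonzero q by (simp add: base_def w_prod w_power_int pairing_def)
  have inf: "torus_valuation w (\<phi> place_inf) = q"
    by (simp add: torus_valuation_def \<phi>_place_inf base the_pairing)
  have at: "torus_valuation w (\<phi> (place_at z)) = q + (\<Sum>i\<in>I. w (z - a i) *s rat_vec (s i))"
    if z: "z \<notin> a ` I" for z
  proof -
    have nz: "i \<in> I \<Longrightarrow> z - a i \<noteq> 0" for i
      using z by auto
    have "w (\<phi> (place_at z) l) = pairing l (q + (\<Sum>i\<in>I. w (z - a i) *s rat_vec (s i)))" for l
    proof -
      have "w (\<phi> (place_at z) l) = w (base l) + w (\<Prod>i\<in>I. (z - a i) powi pairing l (s i))"
        using nz finite_I by (simp add: \<phi>_place_at[OF z] w_mult power_int_eq_0_iff)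
      also have "w (\<Prod>i\<in>I. (z - a i) powi pairing l (s i)) = (\<Sum>i\<in>I. w (z - a i) * pairing l (rat_vec (s i)))"
        using nz by (subst w_prod) (auto simp: power_int_eq_0_iff w_power_int pairing_rat_vec mult.commute intro!: sum.cong)
      finally show ?thesis
        by (simp add: base pairing_add_right pairing_sum_right pairing_scale_right)
    qed
    then show ?thesis
      by (simp add: torus_valuation_def the_pairing)
  qed
  have "U = insert place_inf (place_at ` (- a ` I))"
    by (auto elim: U_cases intro: place_in_U)
  then show ?thesis
    using inf at by (simp add: Trop_def image_image)
qed

end


section \<open>Primitive vectors\<close>

lemma rat_vec_eq_iff [simp]: "rat_vec x = rat_vec y \<longleftrightarrow> x = y"
  by (simp add: rat_vec_def vec_eq_iff)

lemma rat_vec_0 [simp]: "rat_vec 0 = 0"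
  by (simp add: rat_vec_def vec_eq_iff)

lemma rat_vec_minus: "rat_vec (- x) = - rat_vec x"
  by (simp add: rat_vec_def vec_eq_iff)

lemma rat_vec_add: "rat_vec (x + y) = rat_vec x + rat_vec y"
  by (simp add: rat_vec_def vec_eq_iff)

lemma rat_vec_scale: "rat_vec (d *s x) = of_int d *s rat_vec x"
  by (simp add: rat_vec_def vec_eq_iff)

lemma rat_vec_sum: "rat_vec (\<Sum>i\<in>A. f i) = (\<Sum>i\<in>A. rat_vec (f i))"
  by (induction A rule: infinite_finite_induct) (simp_all add: rat_vec_add)

lemma primitive_vec_coprime_scale:
  assumes "primitive_vec x" "p *s x = q *s y" "coprime p q" "0 < q"
  shows "q = 1"
proof -
  have "q dvd x $ i" for i
  proof -
    have "p * x $ i = q * y $ i"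
      using assms(2) by (metis vector_smult_component)
    then show ?thesis
      using assms(3) by (metis coprime_commute coprime_dvd_mult_right_iff dvd_triv_left)
  qed
  then have "x = q *s (\<chi> i. x $ i div q)"
    by (simp add: vec_eq_iff)
  then have "\<bar>q\<bar> = 1"
    using assms(1) unfolding primitive_vec_def by blast
  then show ?thesis
    using assms(4) by simp
qed

text \<open>Write c/d = p/q in lowest terms. From p x = q y it follows that q divides all entries of
  x and p all entries of y, so primitivity leaves p = q = 1.\<close>

lemma primitive_vec_unique:
  assumes "primitive_vec x" "primitive_vec y" "0 < c" "0 < d" "c *s rat_vec x = d *s rat_vec y"
  shows "x = y"
proof -
  obtain p q where pq: "quotient_of (c / d) = (p, q)"
    by force
  then have q: "0 < q" "coprime p q" and cd: "c / d = of_int p / of_int q"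
    using quotient_of_denom_pos quotient_of_coprime quotient_of_div by blast+
  have "0 < (of_int p :: rat) / of_int q"
    using assms cd[symmetric] by simp
  then have p: "0 < p"
    using q(1) by (simp add: zero_less_divide_iff)
  have "c * of_int q = d * of_int p"
    using cd assms q by (simp add: field_simps)
  have "of_int p * of_int (x $ i) = (of_int q * of_int (y $ i) :: rat)" for i
  proof -
    have "c * of_int (x $ i) = d * of_int (y $ i)"
      using assms(5) by (simp add: vec_eq_iff rat_vec_def)
    then have "d * (of_int p * of_int (x $ i)) = d * (of_int q * of_int (y $ i))"
      using \<open>c * of_int q = d * of_int p\<close> by (metis mult.assoc mult.commute)
    then show ?thesis
      using assms by simp
  qed
  then have eq: "p *s x = q *s y"
    by (simp add: vec_eq_iff flip: of_int_mult)
  have "q = 1" "p = 1"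
    using primitive_vec_coprime_scale[OF assms(1) eq] primitive_vec_coprime_scale[OF assms(2) eq[symmetric]]
      p q by (simp_all add: coprime_commute)
  then show ?thesis
    using eq by simp
qed

text \<open>The product d of the denominators makes b integral; dividing by the gcd of the resulting
  entries makes it primitive.\<close>

lemma primitive_vec_exists:
  assumes "b \<noteq> (0 :: rat ^ 'n)"
  shows "\<exists>r c. primitive_vec r \<and> 0 < c \<and> b = c *s rat_vec r"
proof -
  define d where "d = (\<Prod>i\<in>UNIV. snd (quotient_of (b $ i)))"
  have d: "0 < d"
    unfolding d_def by (intro prod_pos) (simp add: quotient_of_denom_pos')
  have "\<exists>n. of_int n = of_int d * b $ i" for i
  proof -
    obtain p q where pq: "quotient_of (b $ i) = (p, q)"
      by force
    have "snd (quotient_of (b $ i)) dvd d"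
      unfolding d_def by (intro dvd_prodI) auto
    then obtain k where "d = q * k"
      by (auto simp: pq)
    then have "of_int d * b $ i = of_int (p * k)"
      using quotient_of_div[OF pq] quotient_of_denom_pos[OF pq] by simp
    then show ?thesis
      by metis
  qed
  then obtain n where n: "\<And>i. of_int (n i) = of_int d * b $ i"
    by metis
  define g where "g = Gcd (range n)"
  obtain j where "b $ j \<noteq> 0"
    using assms by (auto simp: vec_eq_iff)
  then have "n j \<noteq> 0"
    using n[of j] d by auto
  then have g: "0 < g"
    using Gcd_int_greater_eq_0[of "range n"] by (auto simp: g_def less_le)
  define r :: "int ^ 'n" where "r = (\<chi> i. n i div g)"
  have gr: "g * r $ i = n i" for i
    by (simp add: r_def g_def Gcd_dvd)
  have "primitive_vec r"
    unfolding primitive_vec_def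
  proof (intro conjI allI impI)
    show "r \<noteq> 0"
      using gr[of j] \<open>n j \<noteq> 0\<close> by auto
    fix k s assume "r = k *s s"
    then have "g * k dvd n i" for i
      using gr[of i] by (metis dvd_triv_left mult.assoc vector_smult_component)
    then have "g * k dvd g"
      unfolding g_def by (intro Gcd_greatest) auto
    then show "\<bar>k\<bar> = 1"
      using g by simp
  qed
  moreover have "b = (of_int g / of_int d) *s rat_vec r"
    using d n gr by (simp add: vec_eq_iff rat_vec_def field_simps flip: of_int_mult)
  ultimately show ?thesis
    using g d by (intro exI[of _ r] exI[of _ "of_int g / of_int d"]) simp
qed

lemma primitive_vec_minus:
  assumes "primitive_vec x"
  shows "primitive_vec (- x)"
  unfolding primitive_vec_def
proof (intro conjI allI impI)
  show "- x \<noteq> 0"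
    using assms by (simp add: primitive_vec_def)
  fix k y assume "- x = k *s y"
  then have "x = (- k) *s y"
    by (metis add.inverse_inverse vector_smult_lneg)
  then have "\<bar>- k\<bar> = 1"
    using assms unfolding primitive_vec_def by blast
  then show "\<bar>k\<bar> = 1"
    by simp
qed

lemma primitive_part_scale:
  assumes "primitive_vec r" "0 < d"
  shows "primitive_part (d *s r) = r"
  unfolding primitive_part_def
proof (rule the_equality)
  fix r' assume r': "primitive_vec r' \<and> (\<exists>d'>0. d *s r = d' *s r')"
  then obtain d' where "0 < d'" "d *s r = d' *s r'"
    by blast
  then show "r' = r"
    using r' assms primitive_vec_unique[of r' r "of_int d'" "of_int d"] by (simp flip: rat_vec_scale)
qed (use assms in blast)

lemma edge_interval_two_points: "\<exists>s\<in>edge_interval G e. \<exists>t\<in>edge_interval G e. s < t"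
proof -
  have *: ?thesis if "x \<in> edge_interval G e" "y \<in> edge_interval G e" "x < y" for x y
    using that by blast
  show ?thesis
  proof (cases "tail G e \<in> boundary G")
    case True
    then show ?thesis
      by (intro *[of "- 2" "- 1"]) (simp_all add: edge_interval_def)
  next
    case False
    then show ?thesis
      by (intro *[of "1/3" "1/2"]) (simp_all add: edge_interval_def)
  qed
qed

text \<open>Two points of the interval detect the slope b, and the primitive vector on the ray of b
  is unique, so the description operator returns it.\<close>

lemma edge_direction_affine:
  assumes "\<And>t. t \<in> edge_interval G e \<Longrightarrow> \<iota> (Edge_Point e t) = x + t *s b"
  shows "b = 0 \<and> edge_direction G \<iota> e = 0 \<or>
    primitive_vec (edge_direction G \<iota> e) \<and> (\<exists>c>0. b = c *s rat_vec (edge_direction G \<iota> e))"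
proof (cases "b = 0")
  case True
  then show ?thesis
    using assms by (simp add: edge_direction_def)
next
  case False
  obtain s t where st: "s \<in> edge_interval G e" "t \<in> edge_interval G e" "s < t"
    using edge_interval_two_points[of G e] by blast
  have diff: "\<iota> (Edge_Point e v) - \<iota> (Edge_Point e u) = (v - u) *s b"
    if "u \<in> edge_interval G e" "v \<in> edge_interval G e" for u v
    using assms that by (simp add: vector_sub_rdistrib)
  have nonconst: "\<not> (\<forall>s\<in>edge_interval G e. \<forall>t\<in>edge_interval G e. \<iota> (Edge_Point e s) = \<iota> (Edge_Point e t))"
  proof
    assume "\<forall>s\<in>edge_interval G e. \<forall>t\<in>edge_interval G e. \<iota> (Edge_Point e s) = \<iota> (Edge_Point e t)"
    then have "\<iota> (Edge_Point e t) = \<iota> (Edge_Point e s)"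
      using st by blast
    then show False
      using diff[OF st(1,2)] st False by simp
  qed
  obtain r c where r: "primitive_vec r" "0 < c" "b = c *s rat_vec r"
    using primitive_vec_exists[OF False] by blast
  have "edge_direction G \<iota> e = r"
    unfolding edge_direction_def if_not_P[OF nonconst]
  proof (rule the_equality)
    show "primitive_vec r \<and> (\<forall>s\<in>edge_interval G e. \<forall>t\<in>edge_interval G e. s < t \<longrightarrow>
        (\<exists>c>0. \<iota> (Edge_Point e t) - \<iota> (Edge_Point e s) = c *s rat_vec r))"
    proof (intro conjI ballI impI)
      fix u v assume uv: "u \<in> edge_interval G e" "v \<in> edge_interval G e" "u < v"
      then show "\<exists>c>0. \<iota> (Edge_Point e v) - \<iota> (Edge_Point e u) = c *s rat_vec r"
        using r diff[OF uv(1,2)] by (intro exI[of _ "(v - u) * c"]) simp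
    qed (rule r)
    fix r' assume "primitive_vec r' \<and> (\<forall>s\<in>edge_interval G e. \<forall>t\<in>edge_interval G e. s < t \<longrightarrow>
        (\<exists>c>0. \<iota> (Edge_Point e t) - \<iota> (Edge_Point e s) = c *s rat_vec r'))"
    then obtain c' where "primitive_vec r'" "0 < c'" "(t - s) *s b = c' *s rat_vec r'"
      using st diff[OF st(1,2)] by metis
    then show "r' = r"
      using r st primitive_vec_unique[of r' r c' "(t - s) * c"] by simp
  qed
  then show ?thesis
    using r by blast
qed


section \<open>From trees to curves\<close>

text \<open>Bundles the conclusion, since trees with an interior vertex and lines reach it
  separately.\<close>

definition rational_realisation :: "('k::field \<Rightarrow> rat) \<Rightarrow> (int ^ 'n) set \<Rightarrow> (rat ^ 'n) set \<Rightarrow> bool" where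
  "rational_realisation w \<delta> Z \<longleftrightarrow>
    (\<exists>(F :: 'k universal set) U (\<phi> :: 'k point \<Rightarrow> int ^ 'n \<Rightarrow> 'k).
      smooth_curve F U \<and> genus F = 0 \<and> torus_map F U \<phi> \<and>
      (\<forall>x\<in>smooth_completion F - U. \<not> extends_to F U \<phi> x) \<and>
      curve_degree F U \<phi> = \<delta> \<and> Trop w U \<phi> = Z)"

lemma curve_of_weighted_tree:
  fixes w :: "'k::alg_closed_field \<Rightarrow> rat" and s :: "'c \<Rightarrow> int ^ 'n"
  assumes tree: "weighted_tree N r p rk L D (\<lambda>c. rat_vec (s c)) q"
    and w: "alg_closed_valued_field w"
    and leaves: "\<And>i. i \<in> L \<Longrightarrow> s i = d i *s \<rho> i \<and> primitive_vec (\<rho> i) \<and> 0 < d i"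
  shows "rational_realisation w ((\<lambda>l. (\<Sum>i | i \<in> L \<and> \<rho> i = l. d i) *s l) ` \<rho> ` L)
    (weighted_tree.image N r p L D (\<lambda>c. rat_vec (s c)) q)"
proof -
  interpret T: weighted_tree N r p rk L D "\<lambda>c. rat_vec (s c)" q
    by fact
  interpret w: alg_closed_valued_field w
    by fact
  obtain a where a: "inj_on a L"
    "insert (q r) ((\<lambda>z. q r + (\<Sum>i\<in>L. w (z - a i) *s rat_vec (s i))) ` (- a ` L))
       = weighted_tree.image N r p L D (\<lambda>c. rat_vec (s c)) q"
    using tree_realisation[OF tree w] by blast
  obtain c where c: "\<And>j. c j \<noteq> 0" "\<And>j. w (c j) = q r $ j"
    using choice[of "\<lambda>j x. x \<noteq> 0 \<and> w x = q r $ j"] w.w_surj by auto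
  \<comment> \<open>With the weight constantly 1 all differences in the summation by parts
    vanish.\<close>
  have "rat_vec (\<Sum>i\<in>L. s i) = 0"
    using T.sum_leaves[of "\<lambda>_. 1"] by (simp add: rat_vec_sum)
  then have sum: "(\<Sum>i\<in>L. s i) = 0"
    by (metis rat_vec_0 rat_vec_eq_iff)
  interpret C: punctured_line L a s c
  proof
    show "finite L"
      using T.L_sub T.finite_N by (rule finite_subset)
    show "s i \<noteq> 0" if "i \<in> L" for i
      using leaves[OF that] by (auto simp: primitive_vec_def vec_eq_iff)
  qed (use a sum c in auto)
  have pp: "primitive_part (s i) = \<rho> i" if "i \<in> L" for i
    using leaves[OF that] primitive_part_scale by metis
  have "curve_degree ratfuns C.U C.\<phi> = (\<lambda>l. (\<Sum>i | i \<in> L \<and> \<rho> i = l. d i) *s l) ` \<rho> ` L"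
    unfolding C.curve_degree_eq
  proof (rule image_cong)
    show "(\<lambda>i. primitive_part (s i)) ` L = \<rho> ` L"
      using pp by simp
    fix l
    have "(\<Sum>i | i \<in> L \<and> primitive_part (s i) = l. s i) = (\<Sum>i | i \<in> L \<and> \<rho> i = l. d i *s l)"
      using pp leaves by (intro sum.cong) auto
    also have "\<dots> = (\<Sum>i | i \<in> L \<and> \<rho> i = l. d i) *s l"
      by (simp add: vec_eq_iff sum_distrib_right)
    finally show "(\<Sum>i | i \<in> L \<and> primitive_part (s i) = l. s i) = (\<Sum>i | i \<in> L \<and> \<rho> i = l. d i) *s l" .
  qed
  moreover have "Trop w C.U C.\<phi> = weighted_tree.image N r p L D (\<lambda>c. rat_vec (s c)) q"
    using C.Trop_eq[OF w.valued_field_axioms c(2)] a(2) by simp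
  ultimately show ?thesis
    using C.smooth_curve genus_ratfuns C.torus_map C.not_extends
    unfolding rational_realisation_def by blast
qed


section \<open>From zero tension curves to trees\<close>

locale rooted_tension_tree = rooted_acyclic_graph G r
  for G :: "('a, 'b) pre_digraph" and r +
  fixes \<iota> :: "('a, 'b) graph_point \<Rightarrow> rat ^ 'n" and m :: "'b \<Rightarrow> nat"
  assumes zero_tension: "zero_tension_curve G \<iota> m"
begin

abbreviation "N \<equiv> verts G - {r}"

lemma edge_in_arcs: "c \<in> N \<Longrightarrow> edge c \<in> arcs G"
  using joins_edge by (auto simp: joins_def)

lemma affine: "c \<in> N \<Longrightarrow> affine_on_edge G \<iota> (edge c)"
  using zero_tension edge_in_arcs by (auto simp: zero_tension_curve_def)

lemma m_pos: "c \<in> N \<Longrightarrow> 0 < m (edge c)"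
  using zero_tension edge_in_arcs by (auto simp: zero_tension_curve_def)

lemma parent_in_verts: "c \<in> N \<Longrightarrow> parent c \<in> verts G"
  using joins_edge joins_verts by blast

lemma parent_neq: "c \<in> N \<Longrightarrow> parent c \<noteq> c"
  using rk_parent by (metis n_not_Suc_n)

lemma edge_eq_iff: "c \<in> N \<Longrightarrow> c' \<in> N \<Longrightarrow> edge c = edge c' \<longleftrightarrow> c = c'"
  using inj_on_edge by (auto dest: inj_onD)

lemma boundary_iff: "u \<in> boundary G \<longleftrightarrow> u \<in> verts G \<and> card (edges_at G u) = 1"
  by (simp add: boundary_def degree_eq_card_edges_at)

text \<open>The edge to its own parent and the edge to c are two different edges at this vertex. The
  root lacks the former, hence the exception.\<close>

lemma parent_not_boundary:
  assumes "c \<in> N" "parent c \<noteq> r"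
  shows "parent c \<notin> boundary G"
proof
  assume "parent c \<in> boundary G"
  then have card: "card (edges_at G (parent c)) = 1"
    by (simp add: boundary_iff)
  have "{edge (parent c), edge c} \<subseteq> edges_at G (parent c)"
    using edges_at_eq[OF parent_in_verts[OF assms(1)]] assms by auto
  moreover have "edge (parent c) \<noteq> edge c"
    using assms parent_in_verts parent_neq edge_eq_iff by (metis Diff_iff singletonD)
  ultimately show False
    using card by (metis card_1_singletonE insert_subset singletonD)
qed

lemma boundary_edges_at:
  assumes "u \<in> boundary G" "u \<noteq> r"
  shows "edges_at G u = {edge u}"
proof -
  have "u \<in> verts G"
    using assms by (simp add: boundary_iff)
  moreover from this have "{c \<in> N. parent c = u} = {}"
    using assms parent_not_boundary by blast
  ultimately show ?thesis
    using edges_at_eq[of u] assms by (simp only: image_empty if_False Un_empty_right)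
qed

definition direction :: "'a \<Rightarrow> int ^ 'n" where
  "direction c = rho G \<iota> (parent c) (edge c)"

lemma rho_child: "c \<in> N \<Longrightarrow> rho G \<iota> c (edge c) = - direction c"
  using joins_edge[of c] parent_neq[of c] by (auto simp: direction_def rho_def joins_def)

text \<open>Removes the arbitrary orientation: every edge is parametrised from its parent end, a
  segment by (0, 1) and a ray by the positive numbers. For an edge pointing towards the root, \<tau>
  reverses the parameter.\<close>

lemma edge_shape:
  assumes c: "c \<in> N" and p: "parent c \<notin> boundary G"
  obtains b where
    "(\<lambda>t. \<iota> (Edge_Point (edge c) t)) ` edge_interval G (edge c)
       = {\<iota> (Vertex (parent c)) + t *s b | t. 0 < t \<and> (c \<in> boundary G \<or> t < 1)}"
    "b = 0 \<and> direction c = 0 \<or> primitive_vec (direction c) \<and> (\<exists>k>0. b = k *s rat_vec (direction c))"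
    "c \<in> boundary G \<Longrightarrow> b \<noteq> 0"
    "c \<notin> boundary G \<Longrightarrow> \<iota> (Vertex c) = \<iota> (Vertex (parent c)) + b"
proof -
  note aff = affine[OF c, unfolded affine_on_edge_def]
  consider (out) "tail G (edge c) = parent c" "head G (edge c) = c"
    | (inw) "head G (edge c) = parent c" "tail G (edge c) = c"
    using joins_edge[OF c] by (auto simp: joins_def)
  then show ?thesis
  proof cases
    case out
    have int: "edge_interval G (edge c) = (if c \<in> boundary G then {0<..} else {0<..<1})"
      using out p by (simp add: edge_interval_def)
    obtain b where b: "\<And>t. t \<in> edge_interval G (edge c) \<Longrightarrow>
        \<iota> (Edge_Point (edge c) t) = \<iota> (Vertex (parent c)) + t *s b"
      "c \<in> boundary G \<Longrightarrow> b \<noteq> 0" "c \<notin> boundary G \<Longrightarrow> \<iota> (Vertex c) = \<iota> (Vertex (parent c)) + b"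
    proof (cases "c \<in> boundary G")
      case True
      then obtain b where "b \<noteq> 0" "\<forall>t>0. \<iota> (Edge_Point (edge c) t) = \<iota> (Vertex (parent c)) + t *s b"
        using aff out p by auto
      then show ?thesis
        using that[of b] True int by simp
    next
      case False
      then have "\<forall>t. 0 < t \<longrightarrow> t < 1 \<longrightarrow> \<iota> (Edge_Point (edge c) t)
          = (1 - t) *s \<iota> (Vertex (parent c)) + t *s \<iota> (Vertex c)"
        using aff out p by auto
      then show ?thesis
        using that[of "\<iota> (Vertex c) - \<iota> (Vertex (parent c))"] False int
        by (simp add: vector_sub_rdistrib vector_ssub_ldistrib)
    qed
    have "direction c = edge_direction G \<iota> (edge c)"
      using out by (simp add: direction_def rho_def)
    moreover have "(\<lambda>t. \<iota> (Edge_Point (edge c) t)) ` edge_interval G (edge c)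
       = {\<iota> (Vertex (parent c)) + t *s b | t. 0 < t \<and> (c \<in> boundary G \<or> t < 1)}"
      using b(1) by (auto simp: int split: if_splits)
    ultimately show ?thesis
      using that[of b] b(2,3) edge_direction_affine[of G "edge c" \<iota> "\<iota> (Vertex (parent c))" b, OF b(1)] by simp
  next
    case inw
    have int: "edge_interval G (edge c) = (if c \<in> boundary G then {..<0} else {0<..<1})"
      using inw p by (simp add: edge_interval_def)
    define \<tau> :: "rat \<Rightarrow> rat" where "\<tau> t = (if c \<in> boundary G then - t else 1 - t)" for t
    obtain b where b: "\<And>t. t \<in> edge_interval G (edge c) \<Longrightarrow>
        \<iota> (Edge_Point (edge c) t) = \<iota> (Vertex (parent c)) + \<tau> t *s b"
      "c \<in> boundary G \<Longrightarrow> b \<noteq> 0" "c \<notin> boundary G \<Longrightarrow> \<iota> (Vertex c) = \<iota> (Vertex (parent c)) + b"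
    proof (cases "c \<in> boundary G")
      case True
      then obtain b where "b \<noteq> 0" "\<forall>t<0. \<iota> (Edge_Point (edge c) t) = \<iota> (Vertex (parent c)) + t *s b"
        using aff inw p by auto
      then show ?thesis
        using that[of "- b"] True int by (simp add: \<tau>_def vec_eq_iff)
    next
      case False
      then have "\<forall>t. 0 < t \<longrightarrow> t < 1 \<longrightarrow> \<iota> (Edge_Point (edge c) t)
          = (1 - t) *s \<iota> (Vertex c) + t *s \<iota> (Vertex (parent c))"
        using aff inw p by auto
      then show ?thesis
        using that[of "\<iota> (Vertex c) - \<iota> (Vertex (parent c))"] False int
        by (simp add: \<tau>_def vec_eq_iff algebra_simps)
    qed
    have "\<iota> (Edge_Point (edge c) t) = (\<iota> (Vertex (parent c)) + \<tau> 0 *s b) + t *s (- b)"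
      if "t \<in> edge_interval G (edge c)" for t
      using b(1)[OF that] by (simp add: \<tau>_def vec_eq_iff algebra_simps)
    note edge_direction_affine[OF this]
    then have "- b = 0 \<and> - direction c = 0 \<or>
        primitive_vec (- direction c) \<and> (\<exists>k>0. - b = k *s rat_vec (- direction c))"
      using inw parent_neq[OF c] by (auto simp: direction_def rho_def)
    then have "b = 0 \<and> direction c = 0 \<or> primitive_vec (direction c) \<and> (\<exists>k>0. b = k *s rat_vec (direction c))"
      using primitive_vec_minus[of "- direction c"] by (auto simp: rat_vec_minus)
    moreover have "(\<lambda>t. \<iota> (Edge_Point (edge c) t)) ` edge_interval G (edge c)
       = (\<lambda>t. \<iota> (Vertex (parent c)) + t *s b) ` \<tau> ` edge_interval G (edge c)"
      using b(1) by (auto simp: image_image)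
    moreover have "\<tau> ` edge_interval G (edge c) = {t. 0 < t \<and> (c \<in> boundary G \<or> t < 1)}"
    proof -
      have "t \<in> \<tau> ` edge_interval G (edge c)" if "0 < t \<and> (c \<in> boundary G \<or> t < 1)" for t
        using that by (intro image_eqI[of _ _ "\<tau> t"]) (auto simp: \<tau>_def int)
      then show ?thesis
        by (auto simp: \<tau>_def int split: if_splits)
    qed
    ultimately show ?thesis
      using that[of b] b(2,3) by auto
  qed
qed

text \<open>Each end has just one edge and distinct ends have distinct edges, so sums over edges
  become sums over leaves.\<close>

lemma tropical_degree_eq:
  assumes "r \<notin> boundary G"
  shows "tropical_degree G \<iota> m
    = (\<lambda>l. (\<Sum>i | i \<in> boundary G \<and> direction i = l. int (m (edge i))) *s l) ` direction ` boundary G"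
proof -
  have sub: "boundary G \<subseteq> N"
    using assms by (auto simp: boundary_iff)
  have edges: "edges_at G u = {edge u}" if "u \<in> boundary G" for u
    using that assms boundary_edges_at by blast
  have rho: "- rho G \<iota> u (edge u) = direction u" if "u \<in> boundary G" for u
    using rho_child[OF subsetD[OF sub that]] by simp
  have "{- rho G \<iota> u e | u e. u \<in> boundary G \<and> e \<in> edges_at G u}
      = (\<Union>u\<in>boundary G. (\<lambda>e. - rho G \<iota> u e) ` edges_at G u)"
    by blast
  also have "\<dots> = (\<Union>u\<in>boundary G. {direction u})"
    by (intro SUP_cong refl) (simp add: edges rho)
  also have "\<dots> = direction ` boundary G"
    by blast
  finally have D: "{- rho G \<iota> u e | u e. u \<in> boundary G \<and> e \<in> edges_at G u} = direction ` boundary G" .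
  have "(\<Sum>e | \<exists>u\<in>boundary G. e \<in> edges_at G u \<and> - rho G \<iota> u e = l. int (m e))
      = (\<Sum>i | i \<in> boundary G \<and> direction i = l. int (m (edge i)))" for l
  proof -
    have "{e. \<exists>u\<in>boundary G. e \<in> edges_at G u \<and> - rho G \<iota> u e = l}
        = (\<Union>u\<in>boundary G. {e \<in> edges_at G u. - rho G \<iota> u e = l})"
      by blast
    also have "\<dots> = (\<Union>u\<in>boundary G. if direction u = l then {edge u} else {})"
      by (intro SUP_cong refl) (auto simp: edges rho)
    also have "\<dots> = edge ` {i \<in> boundary G. direction i = l}"
      by auto
    finally have "{e. \<exists>u\<in>boundary G. e \<in> edges_at G u \<and> - rho G \<iota> u e = l}
        = edge ` {i \<in> boundary G. direction i = l}" .
    moreover have "inj_on edge {i \<in> boundary G. direction i = l}"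
      using inj_on_edge by (rule inj_on_subset) (use sub in auto)
    ultimately show ?thesis
      by (simp add: sum.reindex)
  qed
  then show ?thesis
    unfolding tropical_degree_def Let_def D by simp
qed

text \<open>Seen from v, the edge to the parent points against its outward direction, so its term
  changes sides in the tension equation.\<close>

lemma balance_at:
  assumes "v \<in> verts G" "v \<notin> boundary G"
  shows "(\<Sum>c | c \<in> N \<and> parent c = v. int (m (edge c)) *s direction c)
    = (if v = r then 0 else int (m (edge v)) *s direction v)"
proof -
  let ?f = "\<lambda>e. int (m e) *s rho G \<iota> v e"
  let ?C = "{c \<in> N. parent c = v}"
  have "(\<Sum>c\<in>?C. int (m (edge c)) *s direction c) = (\<Sum>c\<in>?C. ?f (edge c))"
    by (intro sum.cong) (auto simp: direction_def)
  also have "\<dots> = sum ?f (edge ` ?C)"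
    using inj_on_subset[OF inj_on_edge, of ?C] by (subst sum.reindex) auto
  finally have C: "(\<Sum>c\<in>?C. int (m (edge c)) *s direction c) = sum ?f (edge ` ?C)" .
  have zero: "sum ?f (edges_at G v) = 0"
    using zero_tension assms by (simp add: zero_tension_curve_def)
  show ?thesis
  proof (cases "v = r")
    case True
    then show ?thesis
      using zero edges_at_eq[OF assms(1)] C by simp
  next
    case False
    then have v: "v \<in> N"
      using assms by simp
    then have "edge v \<notin> edge ` ?C"
      using edge_eq_iff parent_neq by auto
    then have "sum ?f (edges_at G v) = ?f (edge v) + sum ?f (edge ` ?C)"
      using edges_at_eq[OF assms(1)] False finite_verts by simp
    then show ?thesis
      using zero C False rho_child[OF v] by (simp add: vector_smult_rneg)
  qed
qed

text \<open>A contracted edge has direction \<open>0\<close>, so every positive number is a length of it.\<close>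

definition has_length :: "'a \<Rightarrow> rat \<Rightarrow> bool" where
  "has_length c l \<longleftrightarrow> 0 < l \<and>
    (\<lambda>t. \<iota> (Edge_Point (edge c) t)) ` edge_interval G (edge c)
      = {\<iota> (Vertex (parent c)) + t *s rat_vec (int (m (edge c)) *s direction c) | t.
         0 < t \<and> (c \<in> boundary G \<or> t < l)} \<and>
    (c \<notin> boundary G \<longrightarrow>
      \<iota> (Vertex c) = \<iota> (Vertex (parent c)) + l *s rat_vec (int (m (edge c)) *s direction c)) \<and>
    (c \<in> boundary G \<longrightarrow> primitive_vec (direction c))"

lemma ex_length:
  assumes "c \<in> N" "parent c \<notin> boundary G"
  shows "\<exists>l. has_length c l"
proof -
  obtain b where b: "(\<lambda>t. \<iota> (Edge_Point (edge c) t)) ` edge_interval G (edge c)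
     = {\<iota> (Vertex (parent c)) + t *s b | t. 0 < t \<and> (c \<in> boundary G \<or> t < 1)}"
    "b = 0 \<and> direction c = 0 \<or> primitive_vec (direction c) \<and> (\<exists>k>0. b = k *s rat_vec (direction c))"
    "c \<in> boundary G \<Longrightarrow> b \<noteq> 0"
    "c \<notin> boundary G \<Longrightarrow> \<iota> (Vertex c) = \<iota> (Vertex (parent c)) + b"
    using edge_shape[OF assms] by blast
  show ?thesis
  proof (cases "b = 0")
    case True
    then have "direction c = 0" "c \<notin> boundary G"
      using b(2,3) by (auto simp: primitive_vec_def vec_eq_iff rat_vec_def)
    then show ?thesis
      using b(1,4) True by (intro exI[of _ 1]) (simp add: has_length_def)
  next
    case False
    then obtain k where k: "0 < k" "b = k *s rat_vec (direction c)" "primitive_vec (direction c)"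
      using b(2) by auto
    \<comment> \<open>\<open>k\<close> counts primitive vectors, whereas lengths count weighted
      directions, so the multiplicity is divided out.\<close>
    define l where "l = k / of_nat (m (edge c))"
    have l: "0 < l" "b = l *s rat_vec (int (m (edge c)) *s direction c)"
      using k m_pos[OF assms(1)] by (simp_all add: l_def rat_vec_scale)
    have "{x + t *s b | t. 0 < t \<and> (c \<in> boundary G \<or> t < 1)}
        = {x + t *s rat_vec (int (m (edge c)) *s direction c) | t. 0 < t \<and> (c \<in> boundary G \<or> t < l)}" for x
    proof (intro equalityI subsetI)
      fix y assume "y \<in> {x + t *s b | t. 0 < t \<and> (c \<in> boundary G \<or> t < 1)}"
      then obtain t where "y = x + t *s b" "0 < t" "c \<in> boundary G \<or> t < 1"
        by blast
      then show "y \<in> {x + t *s rat_vec (int (m (edge c)) *s direction c) | t. 0 < t \<and> (c \<in> boundary G \<or> t < l)}"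
        using l by (intro CollectI exI[of _ "t * l"]) auto
    next
      fix y assume "y \<in> {x + t *s rat_vec (int (m (edge c)) *s direction c) | t. 0 < t \<and> (c \<in> boundary G \<or> t < l)}"
      then obtain t where "y = x + t *s rat_vec (int (m (edge c)) *s direction c)" "0 < t" "c \<in> boundary G \<or> t < l"
        by blast
      then show "y \<in> {x + t *s b | t. 0 < t \<and> (c \<in> boundary G \<or> t < 1)}"
        using l by (intro CollectI exI[of _ "t / l"]) auto
    qed
    then show ?thesis
      using b l k by (intro exI[of _ l]) (simp add: has_length_def)
  qed
qed

lemma curve_of_interior_root:
  fixes w :: "'k::alg_closed_field \<Rightarrow> rat"
  assumes root_interior: "r \<notin> boundary G" and w: "alg_closed_valued_field w"
  shows "rational_realisation w (tropical_degree G \<iota> m) (\<iota> ` points_off_boundary G)"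
proof -
  \<comment> \<open>With an interior root no parent is an end, so every edge is a segment or a ray
    starting at its parent.\<close>
  have pb: "parent c \<notin> boundary G" if "c \<in> N" for c
    using parent_not_boundary[OF that] root_interior by metis
  obtain len where "\<And>c. c \<in> N \<Longrightarrow> has_length c (len c)"
    using ex_length pb by metis
  then have len: "0 < len c"
    and edge_image: "(\<lambda>t. \<iota> (Edge_Point (edge c) t)) ` edge_interval G (edge c)
      = {\<iota> (Vertex (parent c)) + t *s rat_vec (int (m (edge c)) *s direction c) | t.
         0 < t \<and> (c \<in> boundary G \<or> t < len c)}"
    and vertex: "c \<notin> boundary G \<Longrightarrow>
      \<iota> (Vertex c) = \<iota> (Vertex (parent c)) + len c *s rat_vec (int (m (edge c)) *s direction c)"
    and prim: "c \<in> boundary G \<Longrightarrow> primitive_vec (direction c)" if "c \<in> N" for c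
    using that unfolding has_length_def by blast+
  have L_sub: "boundary G \<subseteq> N"
    using root_interior by (auto simp: boundary_iff)
  interpret T: rooted_tree N r parent rk "boundary G"
    using L_sub parent_in_verts pb rk_root rk_parent finite_verts by unfold_locales auto
  obtain D :: "'a \<Rightarrow> rat" where D: "\<And>c. c \<in> N \<Longrightarrow> D c = len c + D (parent c)"
    using T.tree_recursion[of 0 "\<lambda>c x. len c + x"] by blast
  let ?s = "\<lambda>c. int (m (edge c)) *s direction c"
  interpret W: weighted_tree N r parent rk "boundary G" D "\<lambda>c. rat_vec (?s c)" "\<lambda>v. \<iota> (Vertex v)"
  proof
    show "D (parent c) < D c" if "c \<in> N - boundary G" for c
      using that D[of c] len[of c] by simp
    show "rat_vec (?s v) = (\<Sum>c | c \<in> N \<and> parent c = v. rat_vec (?s c))" if "v \<in> N - boundary G" for v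
      using that balance_at[of v] by (simp flip: rat_vec_sum)
    show "(\<Sum>c | c \<in> N \<and> parent c = r. rat_vec (?s c)) = 0"
      using balance_at[OF root root_interior] by (simp flip: rat_vec_sum)
    show "\<iota> (Vertex c) = \<iota> (Vertex (parent c)) + (D c - D (parent c)) *s rat_vec (?s c)"
      if "c \<in> N - boundary G" for c
      using that D[of c] vertex[of c] by simp
  qed
  have image: "W.image = \<iota> ` points_off_boundary G"
  proof (intro equalityI subsetI)
    fix y assume "y \<in> W.image"
    then consider "y = \<iota> (Vertex r)"
      | c t where "c \<in> N" "y = \<iota> (Vertex (parent c)) + t *s rat_vec (?s c)" "0 < t"
          "c \<in> boundary G \<or> t \<le> D c - D (parent c)"
      unfolding W.image_def by blast
    then show "y \<in> \<iota> ` points_off_boundary G"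
    proof cases
      case 1
      then show ?thesis
        using root root_interior by (auto simp: points_off_boundary_def)
    next
      case (2 c t)
      show ?thesis
      proof (cases "c \<notin> boundary G \<and> t = len c")
        case True
        then have "y = \<iota> (Vertex c)"
          using vertex[OF 2(1)] 2 by simp
        then show ?thesis
          using True 2(1) by (auto simp: points_off_boundary_def)
      next
        case False
        then have "c \<in> boundary G \<or> t < len c"
          using 2(4) D[OF 2(1)] by auto
        then have "y \<in> (\<lambda>t. \<iota> (Edge_Point (edge c) t)) ` edge_interval G (edge c)"
          unfolding edge_image[OF 2(1)] using 2 by blast
        then show ?thesis
          using edge_in_arcs[OF 2(1)] by (auto simp: points_off_boundary_def)
      qed
    qed
  next
    fix y assume "y \<in> \<iota> ` points_off_boundary G"
    then consider v where "v \<in> verts G" "v \<notin> boundary G" "y = \<iota> (Vertex v)"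
      | e t where "e \<in> arcs G" "t \<in> edge_interval G e" "y = \<iota> (Edge_Point e t)"
      unfolding points_off_boundary_def by blast
    then show "y \<in> W.image"
    proof cases
      case (1 v)
      show ?thesis
      proof (cases "v = r")
        case True
        then show ?thesis
          using 1 by (simp add: W.image_def)
      next
        case False
        then have "v \<in> N"
          using 1 by simp
        then show ?thesis
          using vertex[of v] len[of v] D[of v] 1 unfolding W.image_def by fastforce
      qed
    next
      case (2 e t)
      then obtain c where c: "c \<in> N" "e = edge c"
        using arcE by blast
      then have "y \<in> (\<lambda>t. \<iota> (Edge_Point (edge c) t)) ` edge_interval G (edge c)"
        using 2 by blast
      then obtain u where "y = \<iota> (Vertex (parent c)) + u *s rat_vec (?s c)" "0 < u" "c \<in> boundary G \<or> u < len c"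
        unfolding edge_image[OF c(1)] by blast
      then show ?thesis
        using c(1) D[OF c(1)] unfolding W.image_def by fastforce
    qed
  qed
  have leaves: "?s i = int (m (edge i)) *s direction i \<and> primitive_vec (direction i) \<and> 0 < int (m (edge i))"
    if "i \<in> boundary G" for i
    using that L_sub prim m_pos by auto
  show ?thesis
    using curve_of_weighted_tree[OF W.weighted_tree_axioms w, of "\<lambda>i. int (m (edge i))" direction, OF leaves]
    unfolding image tropical_degree_eq[OF root_interior] .
qed

text \<open>A single edge with both ends in the boundary: the tree has an artificial root \<open>0\<close> on the
  line and the two leaves \<open>1\<close> and \<open>- 1\<close>.\<close>

lemma curve_of_line:
  fixes w :: "'k::alg_closed_field \<Rightarrow> rat"
  assumes all_boundary: "verts G \<subseteq> boundary G" and w: "alg_closed_valued_field w"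
  shows "rational_realisation w (tropical_degree G \<iota> m) (\<iota> ` points_off_boundary G)"
proof -
  \<comment> \<open>A vertex other than the root that has a child is interior, so here every other
    vertex hangs on the root. The root is an end itself, which leaves exactly one other
    vertex.\<close>
  have children: "{v \<in> N. parent v = r} = N"
    using parent_not_boundary parent_in_verts all_boundary by blast
  have "r \<in> boundary G"
    using all_boundary root by blast
  then have "card (edges_at G r) = 1"
    by (simp add: boundary_iff)
  moreover have edges_root: "edges_at G r = edge ` N"
    using edges_at_eq[OF root] children by simp
  ultimately have "card N = 1"
    by (simp add: card_image inj_on_edge)
  then obtain c where c: "N = {c}"
    by (rule card_1_singletonE)
  then have cN: "c \<in> N" and verts: "verts G = {r, c}" and "c \<noteq> r"
    using root by auto
  let ?e = "edge c"
  have arcs: "arcs G = {?e}"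
    using edge_image c by simp
  have "parent c = r"
    using children c by auto
  then have ends: "tail G ?e = r \<and> head G ?e = c \<or> tail G ?e = c \<and> head G ?e = r"
    using joins_edge[OF cN] by (auto simp: joins_def)
  have boundary: "boundary G = {r, c}"
    using all_boundary unfolding verts[symmetric] by (intro equalityI) (simp_all add: boundary_def)
  have edges: "edges_at G u = {?e}" if "u \<in> {r, c}" for u
    using that edges_root boundary_edges_at[of c] boundary \<open>c \<noteq> r\<close> unfolding c by auto
  have both: "tail G ?e \<in> boundary G" "head G ?e \<in> boundary G"
    using ends unfolding boundary by blast+
  then have int: "edge_interval G ?e = UNIV"
    by (simp add: edge_interval_def)
  obtain x b where b: "b \<noteq> 0" "\<And>t. \<iota> (Edge_Point ?e t) = x + t *s b"
    using affine[OF cN] both by (auto simp: affine_on_edge_def)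
  define r0 where "r0 = edge_direction G \<iota> ?e"
  obtain k where k: "primitive_vec r0" "0 < k" "b = k *s rat_vec r0"
    using edge_direction_affine[of G ?e \<iota> x b] b unfolding r0_def by auto
  let ?m = "int (m ?e)"
  have m: "0 < ?m"
    using m_pos[OF cN] by simp
  let ?s = "\<lambda>i :: int. ?m *s (i *s r0)"
  have minus_r0: "(- 1) *s r0 = - r0"
    by (simp add: vec_eq_iff)
  have set_eq: "{i :: int. i = - 1 \<or> i = 1} = {- 1, 1}"
    by blast
  \<comment> \<open>The index i is the sign of the ray with direction \<open>i *s r0\<close>; its
    absolute value is the rank. Both vertices are leaves, so the two rays balance at the
    root.\<close>
  interpret W: weighted_tree "{- 1, 1 :: int}" 0 "\<lambda>_. 0" "\<lambda>i. nat \<bar>i\<bar>" "{- 1, 1}" "\<lambda>_. 0"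
      "\<lambda>i. rat_vec (?s i)" "\<lambda>_. x"
    by unfold_locales (auto simp: rat_vec_scale vec_eq_iff set_eq)
  have leaves: "?s i = ?m *s (i *s r0) \<and> primitive_vec (i *s r0) \<and> 0 < ?m" if "i \<in> {- 1, 1}" for i
    using that k(1) m primitive_vec_minus[of r0] by (auto simp: minus_r0)
  have image: "W.image = \<iota> ` points_off_boundary G"
  proof -
    have "points_off_boundary G = range (Edge_Point ?e)"
      using verts boundary arcs int by (auto simp: points_off_boundary_def)
    then have points: "\<iota> ` points_off_boundary G = range (\<lambda>t. x + t *s b)"
      by (simp add: image_image b(2))
    \<comment> \<open>The factor between weighted directions and b: \<open>?m\<close> times
      \<open>r0\<close> is h times b.\<close>
    define h where "h = of_int ?m / k"
    have h: "0 < h" "rat_vec (?s i) = (of_int i * h) *s b" for i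
      using k m by (simp_all add: h_def rat_vec_scale mult.commute)
    have "W.image = range (\<lambda>t. x + t *s b)"
    proof (intro equalityI subsetI)
      fix y assume "y \<in> W.image"
      then consider "y = x + 0 *s b" | i t where "y = x + t *s rat_vec (?s i)"
        unfolding W.image_def by auto
      then show "y \<in> range (\<lambda>t. x + t *s b)"
      proof cases
        case (2 i t)
        then have "y = x + (t * (of_int i * h)) *s b"
          unfolding h(2) by simp
        then show ?thesis
          by blast
      qed blast
    next
      fix y assume "y \<in> range (\<lambda>t. x + t *s b)"
      then obtain t where t: "y = x + t *s b"
        by blast
      show "y \<in> W.image"
      proof (cases "t = 0")
        case True
        then show ?thesis
          using t unfolding W.image_def by simp
      next
        case False
        \<comment> \<open>The sign of t selects the ray, and it cancels because its square is
          1.\<close>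
        define i :: int where "i = (if t > 0 then 1 else - 1)"
        have i: "i \<in> {- 1, 1}" "of_int i * of_int i = (1 :: rat)" "of_int i * t > 0"
          using False by (auto simp: i_def)
        have "((of_int i * t / h) * (of_int i * h)) = t"
          using h(1) i(2) by (simp add: mult.commute mult.left_commute)
        then have "y = x + (of_int i * t / h) *s rat_vec (?s i)"
          unfolding h(2) t by simp
        moreover have "0 < of_int i * t / h"
          using i h(1) by simp
        ultimately show ?thesis
          using i(1) unfolding W.image_def by blast
      qed
    qed
    then show ?thesis
      using points by simp
  qed
  have "r0 \<noteq> 0"
    using k(1) by (simp add: primitive_vec_def)
  then have "r0 \<noteq> - r0"
    by (auto simp: vec_eq_iff)
  have degree: "(\<lambda>l. (\<Sum>i | i \<in> {- 1, 1 :: int} \<and> i *s r0 = l. ?m) *s l) ` (\<lambda>i. i *s r0) ` {- 1, 1}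
      = {?m *s r0, ?m *s (- r0)}"
  proof -
    have "{i. i \<in> {- 1, 1 :: int} \<and> i *s r0 = r0} = {1}" "{i. i \<in> {- 1, 1 :: int} \<and> i *s r0 = - r0} = {- 1}"
      using \<open>r0 \<noteq> - r0\<close> by (auto simp: minus_r0)
    then show ?thesis
      by (simp add: insert_commute minus_r0)
  qed
  have tropical_degree: "tropical_degree G \<iota> m = {?m *s r0, ?m *s (- r0)}"
  proof -
    have rho: "{- rho G \<iota> r ?e, - rho G \<iota> c ?e} = {r0, - r0}"
      using ends \<open>c \<noteq> r\<close> by (auto simp: rho_def r0_def)
    have "{- rho G \<iota> u e | u e. u \<in> boundary G \<and> e \<in> edges_at G u}
        = (\<Union>u\<in>{r, c}. (\<lambda>e. - rho G \<iota> u e) ` edges_at G u)"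
      unfolding boundary by blast
    also have "\<dots> = {r0, - r0}"
      using rho by (simp add: edges insert_commute)
    finally have D: "{- rho G \<iota> u e | u e. u \<in> boundary G \<and> e \<in> edges_at G u} = {r0, - r0}" .
    have "{e. \<exists>u\<in>boundary G. e \<in> edges_at G u \<and> - rho G \<iota> u e = l} = {?e}" if "l \<in> {r0, - r0}" for l
    proof -
      have "{e. \<exists>u\<in>boundary G. e \<in> edges_at G u \<and> - rho G \<iota> u e = l}
          = (\<Union>u\<in>{r, c}. {e \<in> edges_at G u. - rho G \<iota> u e = l})"
        unfolding boundary by blast
      also have "\<dots> = {?e}"
        using that unfolding rho[symmetric] by (auto simp: edges)
      finally show ?thesis .
    qed
    then show ?thesis
      unfolding tropical_degree_def Let_def D by simp
  qed
  show ?thesis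
    using curve_of_weighted_tree[OF W.weighted_tree_axioms w, of "\<lambda>_. ?m" "\<lambda>i. i *s r0", OF leaves]
    unfolding image degree tropical_degree .
qed

end

text \<open>A uniformizer of the ring keeps its value 1 in the algebraic closure.\<close>

lemma algebraic_closure_valued_field:
  assumes "discrete_valuation_ring v" "extended_valuation v w"
  shows "alg_closed_valued_field w"
proof
  show "w (x * y) = w x + w y" if "x \<noteq> 0" "y \<noteq> 0" for x y
    using assms that by (simp add: extended_valuation_def)
  show "min (w x) (w y) \<le> w (x + y)" if "x \<noteq> 0" "y \<noteq> 0" "x + y \<noteq> 0" for x y
    using assms that by (simp add: extended_valuation_def)
  obtain x where x: "v x = 1"
    using assms by (auto simp: discrete_valuation_ring_def)
  have "v 0 = \<infinity>"
    using assms by (simp add: discrete_valuation_ring_def)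
  then have "x \<noteq> 0"
    using x by auto
  then have "w (to_ac (Fraction_Field.Fract x 1)) = 1" "to_ac (Fraction_Field.Fract x 1) \<noteq> 0"
    using assms x by (simp_all add: extended_valuation_def one_enat_def flip: Zero_fract_def)
      (simp add: Zero_fract_def eq_fract)
  then show "\<exists>x. x \<noteq> 0 \<and> w x = 1"
    by blast
qed

theorem theorem3p2:
  fixes v :: "'o::idom \<Rightarrow> enat"
    and w :: "'o fract alg_closure \<Rightarrow> rat"
    and \<Gamma> :: "('a, 'b) pre_digraph"
    and \<iota> :: "('a, 'b) graph_point \<Rightarrow> rat ^ 'n"
    and m :: "'b \<Rightarrow> nat"
    and \<delta> :: "(int ^ 'n) set"
  assumes "discrete_valuation_ring v"
    and "valuation_complete v"
    and "algebraically_closed (residue_field v)"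
    and "extended_valuation v w"
    and "zero_tension_curve \<Gamma> \<iota> m"
    and "Digraph_Component.connected \<Gamma>"
    and "first_betti_number \<Gamma> = 0"
    and "tropical_degree \<Gamma> \<iota> m = \<delta>"
  shows "\<exists>(F :: 'o fract alg_closure universal set) U (\<phi> :: 'o fract alg_closure point \<Rightarrow> int ^ 'n \<Rightarrow> 'o fract alg_closure).
           smooth_curve F U \<and> genus F = 0 \<and>
           torus_map F U \<phi> \<and> (\<forall>x\<in>smooth_completion F - U. \<not> extends_to F U \<phi> x) \<and>
           curve_degree F U \<phi> = \<delta> \<and>
           \<iota> ` points_off_boundary \<Gamma> = Trop w U \<phi>"
proof -
  have w: "alg_closed_valued_field w"
    using assms(1,4) by (rule algebraic_closure_valued_field)
  have tree: "rooted_tension_tree \<Gamma> r \<iota> m" if "r \<in> verts \<Gamma>" for r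
  proof -
    interpret fin_digraph \<Gamma>
      using assms(5) by (simp add: zero_tension_curve_def)
    show ?thesis
      using assms(5-7) that by unfold_locales
  qed
  \<comment> \<open>If every vertex is an end, the curve is a line; otherwise any interior vertex
    serves as the root.\<close>
  have "rational_realisation w \<delta> (\<iota> ` points_off_boundary \<Gamma>)"
  proof (cases "verts \<Gamma> \<subseteq> boundary \<Gamma>")
    case True
    obtain r where "r \<in> verts \<Gamma>"
      using assms(6) by (auto simp: connected_conv)
    then show ?thesis
      using rooted_tension_tree.curve_of_line[OF tree True w] assms(8) by simp
  next
    case False
    then obtain r where "r \<in> verts \<Gamma>" "r \<notin> boundary \<Gamma>"
      by blast
    then show ?thesis
      using rooted_tension_tree.curve_of_interior_root[OF tree _ w] assms(8) by simp
  qed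
  then show ?thesis
    unfolding rational_realisation_def by (metis (no_types))
qed

end
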